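(* Let $\tau\in\mathbf C$, $\tau\ne 2$. The mapping class group $\mathcal{MCG}$ of the once-punctured torus acts properly discontinuously on $(\mathcal X_\tau)_Q$; that is, for every compact subset $K\subset(\mathcal X_\tau)_Q$ the set $\{H\in\mathcal{MCG} : H(K)\cap K\ne\emptyset\}$ is finite.
   Context: $\Gamma=\langle a,b\rangle$ is the free group of rank two, the fundamental group of a once-punctured torus $\mathbb T$. On $\Gamma$ let $g\sim h$ iff $g$ is conjugate to $h$ or $h^{-1}$; $\hat\Omega\subset\Gamma/\!\sim$ is the set of classes corresponding to non-trivial, non-peripheral simple closed curves on $\mathbb T$ (equivalently, classes of elements belonging to a free basis). A $\tau$-representation is a homomorphism $\rho:\Gamma\to\mathrm{SL}(2,\mathbf C)$ with $\mathrm{tr}\,\rho(aba^{-1}b^{-1})=\tau$. $\mathcal X_\tau$ is the set of $\tau$-representations modulo conjugation in $\mathrm{SL}(2,\mathbf C)$. For $\tau\neq2$, $[\rho]\mapsto(\mathrm{tr}\,\rho(a),\mathrm{tr}\,\rho(b),\mathrm{tr}\,\rho(ab))$ identifies $\mathcal X_\tau$ with $\{(x,y,z)\in\mathbf C^3: x^2+y^2+z^2-xyz=\tau+2\}$, from which $\mathcal X_\tau$ gets its topology. $(\mathcal X_\tau)_Q\subset\mathcal X_\tau$ is the subset of classes of $\rho$ satisfying the BQ-conditions: (BQ1) $\mathrm{tr}\,\rho(g)\notin[-2,2]$ for all $[g]\in\hat\Omega$; (BQ2) $|\mathrm{tr}\,\rho(g)|\le2$ for only finitely many (possibly no) $[g]\in\hat\Omega$.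 $\mathcal{MCG}\cong\mathrm{SL}(2,\mathbf Z)$ acts on $\mathcal X_\tau$ by $H(\rho)(g)=\rho(H_*(g))$, where $H_*$ is the automorphism of $\Gamma$ (well defined up to inner automorphisms) induced by $H$; this action preserves $(\mathcal X_\tau)_Q$. *)

theory Defs
  imports "HOL-Analysis.Analysis" "HOL-Algebra.Bij" "HOL-Algebra.Coset"
begin

section \<open>The free group of rank two\<close>

datatype gen = GenA | GenB

text \<open>A word is a list of letters \<open>(x, s)\<close>; the letter stands for \<open>x\<close> if \<open>s\<close> is true and for
  the formal inverse of \<open>x\<close> otherwise.\<close>

type_synonym word = "(gen \<times> bool) list"

definition cancel :: "word \<Rightarrow> word \<Rightarrow> bool"
  where "cancel v w \<longleftrightarrow> (\<exists>p q x s. v = p @ [(x, s), (x, \<not> s)] @ q \<and> w = p @ q)"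

quotient_type free2 = word / "equivclp cancel"
  by (rule equivp_evquivclp)

lemma cancel_append_left: "cancel v w \<Longrightarrow> cancel (u @ v) (u @ w)"
  unfolding cancel_def by (metis append.assoc)

lemma cancel_append_right: "cancel v w \<Longrightarrow> cancel (v @ u) (w @ u)"
  unfolding cancel_def by fastforce

lemma equivclp_cancel_append_left: "equivclp cancel v w \<Longrightarrow> equivclp cancel (u @ v) (u @ w)"
  by (induction rule: equivclp_induct)
    (auto intro: equivclp_into_equivclp cancel_append_left)

lemma equivclp_cancel_append_right: "equivclp cancel v w \<Longrightarrow> equivclp cancel (v @ u) (w @ u)"
  by (induction rule: equivclp_induct)
    (auto intro: equivclp_into_equivclp cancel_append_right)

lift_definition free2_mult :: "free2 \<Rightarrow> free2 \<Rightarrow> free2" is "(@)"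
  by (meson equivclp_trans equivclp_cancel_append_left equivclp_cancel_append_right)

lift_definition free2_one :: free2 is "[]" .

lift_definition free2_gen :: "gen \<Rightarrow> free2" is "\<lambda>x. [(x, True)]" .

definition \<Gamma> :: "free2 monoid"
  where "\<Gamma> = \<lparr>carrier = UNIV, mult = free2_mult, one = free2_one\<rparr>"

definition gen_a :: free2 where "gen_a = free2_gen GenA"

definition gen_b :: free2 where "gen_b = free2_gen GenB"

definition comm_ab :: free2
  where "comm_ab = gen_a \<otimes>\<^bsub>\<Gamma>\<^esub> gen_b \<otimes>\<^bsub>\<Gamma>\<^esub> inv\<^bsub>\<Gamma>\<^esub> gen_a \<otimes>\<^bsub>\<Gamma>\<^esub> inv\<^bsub>\<Gamma>\<^esub> gen_b"

lemma equivclp_cancel_inverse_word: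
  "equivclp cancel (map (\<lambda>(x, s). (x, \<not> s)) (rev w) @ w) []"
proof (induction w)
  case Nil
  then show ?case by simp
next
  case (Cons l w)
  obtain x s where l: "l = (x, s)" by fastforce
  let ?i = "map (\<lambda>(x, s). (x, \<not> s)) (rev w)"
  have "cancel (?i @ [(x, \<not> s), (x, \<not> \<not> s)] @ w) (?i @ w)"
    unfolding cancel_def by blast
  then have "equivclp cancel (?i @ [(x, \<not> s), (x, s)] @ w) (?i @ w)"
    by (simp add: r_into_equivclp)
  from equivclp_trans[OF this Cons.IH] show ?case
    by (simp add: l)
qed

lemma group_\<Gamma>: "group \<Gamma>"
proof (rule groupI)
  fix x y z assume "x \<in> carrier \<Gamma>" "y \<in> carrier \<Gamma>" "z \<in> carrier \<Gamma>"
  show "x \<otimes>\<^bsub>\<Gamma>\<^esub> y \<otimes>\<^bsub>\<Gamma>\<^esub> z = x \<otimes>\<^bsub>\<Gamma>\<^esub> (y \<otimes>\<^bsub>\<Gamma>\<^esub> z)"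
    unfolding \<Gamma>_def monoid.simps by transfer simp
next
  fix x assume "x \<in> carrier \<Gamma>"
  show "\<one>\<^bsub>\<Gamma>\<^esub> \<otimes>\<^bsub>\<Gamma>\<^esub> x = x"
    unfolding \<Gamma>_def monoid.simps by transfer simp
next
  fix x assume "x \<in> carrier \<Gamma>"
  have "\<exists>y. free2_mult y x = free2_one"
    by transfer (use equivclp_cancel_inverse_word in blast)
  then show "\<exists>y\<in>carrier \<Gamma>. y \<otimes>\<^bsub>\<Gamma>\<^esub> x = \<one>\<^bsub>\<Gamma>\<^esub>"
    by (simp add: \<Gamma>_def)
qed (auto simp: \<Gamma>_def)

section \<open>Free bases and classes of simple closed curves\<close>

text \<open>\<open>(u, v)\<close> is a free basis of \<open>\<Gamma>\<close> iff the endomorphism with \<open>a \<mapsto> u\<close>, \<open>b \<mapsto> v\<close> is bijective.\<close>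

definition free_basis :: "free2 \<Rightarrow> free2 \<Rightarrow> bool"
  where "free_basis u v \<longleftrightarrow> (\<exists>\<phi>\<in>iso \<Gamma> \<Gamma>. \<phi> gen_a = u \<and> \<phi> gen_b = v)"

definition curve_rel :: "(free2 \<times> free2) set"
  where "curve_rel = {(g, h). \<exists>k\<in>carrier \<Gamma>.
    g = k \<otimes>\<^bsub>\<Gamma>\<^esub> h \<otimes>\<^bsub>\<Gamma>\<^esub> inv\<^bsub>\<Gamma>\<^esub> k \<or> g = k \<otimes>\<^bsub>\<Gamma>\<^esub> (inv\<^bsub>\<Gamma>\<^esub> h) \<otimes>\<^bsub>\<Gamma>\<^esub> inv\<^bsub>\<Gamma>\<^esub> k}"

text \<open>If \<open>(v, u)\<close> is a free basis then so is \<open>(u, v)\<close>, so it suffices to take first members.\<close>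

definition Omega_hat :: "free2 set set"
  where "Omega_hat = {g. \<exists>v. free_basis g v} // curve_rel"

section \<open>Representations and the relative character variety\<close>

definition SL2C :: "(complex^2^2) monoid"
  where "SL2C = \<lparr>carrier = {A. det A = 1}, mult = (**), one = mat 1\<rparr>"

lemma group_SL2C: "group SL2C"
proof (rule groupI)
  fix A assume "A \<in> carrier SL2C"
  then have A: "det A = 1" by (simp add: SL2C_def)
  then obtain B where B: "A ** B = mat 1" "B ** A = mat 1"
    using invertible_det_nz[of A] by (auto simp: invertible_def)
  then have "det A * det B = 1" by (metis det_mul det_I)
  then have "det B = 1" using A by simp
  then show "\<exists>B\<in>carrier SL2C. B \<otimes>\<^bsub>SL2C\<^esub> A = \<one>\<^bsub>SL2C\<^esub>"
    using B by (auto simp: SL2C_def)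
qed (auto simp: SL2C_def det_mul matrix_mul_assoc)

definition tau_reps :: "complex \<Rightarrow> (free2 \<Rightarrow> complex^2^2) set"
  where "tau_reps \<tau> = {\<rho> \<in> hom \<Gamma> SL2C. trace (\<rho> comm_ab) = \<tau>}"

definition conj_rel :: "complex \<Rightarrow> ((free2 \<Rightarrow> complex^2^2) \<times> (free2 \<Rightarrow> complex^2^2)) set"
  where "conj_rel \<tau> = {(\<rho>, \<rho>'). \<rho> \<in> tau_reps \<tau> \<and> \<rho>' \<in> tau_reps \<tau> \<and>
    (\<exists>P\<in>carrier SL2C. \<forall>g. \<rho>' g = P \<otimes>\<^bsub>SL2C\<^esub> \<rho> g \<otimes>\<^bsub>SL2C\<^esub> inv\<^bsub>SL2C\<^esub> P)}"

definition X_char :: "complex \<Rightarrow> (free2 \<Rightarrow> complex^2^2) set set"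
  where "X_char \<tau> = tau_reps \<tau> // conj_rel \<tau>"

definition trace_coords :: "(free2 \<Rightarrow> complex^2^2) \<Rightarrow> complex \<times> complex \<times> complex"
  where "trace_coords \<rho> =
    (trace (\<rho> gen_a), trace (\<rho> gen_b), trace (\<rho> (gen_a \<otimes>\<^bsub>\<Gamma>\<^esub> gen_b)))"

text \<open>Trace coordinates are constant on conjugacy classes, so \<open>trace_coords ` c\<close> is a singleton for
  every class \<open>c\<close>. For \<open>\<tau> \<noteq> 2\<close> the map is a bijection of \<open>X_char \<tau>\<close> onto the cubic surface
  \<open>x\<^sup>2 + y\<^sup>2 + z\<^sup>2 - x y z = \<tau> + 2\<close>, whose subspace topology is pulled back.\<close>

definition class_coords :: "(free2 \<Rightarrow> complex^2^2) set \<Rightarrow> complex \<times> complex \<times> complex"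
  where "class_coords c = the_elem (trace_coords ` c)"

definition X_top :: "complex \<Rightarrow> (free2 \<Rightarrow> complex^2^2) set topology"
  where "X_top \<tau> = pullback_topology (X_char \<tau>) class_coords euclidean"

definition BQ1 :: "(free2 \<Rightarrow> complex^2^2) \<Rightarrow> bool"
  where "BQ1 \<rho> \<longleftrightarrow> (\<forall>c\<in>Omega_hat. \<forall>g\<in>c. trace (\<rho> g) \<notin> complex_of_real ` {-2..2})"

text \<open>The trace of \<open>\<rho> g\<close> depends only on the class of \<open>g\<close>, so any representative may be used.\<close>

definition BQ2 :: "(free2 \<Rightarrow> complex^2^2) \<Rightarrow> bool"
  where "BQ2 \<rho> \<longleftrightarrow> finite {c \<in> Omega_hat. \<exists>g\<in>c. cmod (trace (\<rho> g)) \<le> 2}"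

definition X_Q :: "complex \<Rightarrow> (free2 \<Rightarrow> complex^2^2) set set"
  where "X_Q \<tau> = {\<rho> \<in> tau_reps \<tau>. BQ1 \<rho> \<and> BQ2 \<rho>} // conj_rel \<tau>"

section \<open>The mapping class group and its action\<close>

definition letter_exp :: "gen \<Rightarrow> gen \<times> bool \<Rightarrow> int"
  where "letter_exp x l = (if fst l = x then if snd l then 1 else - 1 else 0)"

lift_definition exp_sum :: "gen \<Rightarrow> free2 \<Rightarrow> int"
  is "\<lambda>x w. \<Sum>l\<leftarrow>w. letter_exp x l"
proof -
  fix x and v w :: word
  assume "equivclp cancel v w"
  then show "(\<Sum>l\<leftarrow>v. letter_exp x l) = (\<Sum>l\<leftarrow>w. letter_exp x l)"
    by (induction rule: equivclp_induct) (auto simp: cancel_def letter_exp_def)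
qed

text \<open>The matrix of the induced map on the abelianization \<open>\<int>\<^sup>2\<close> of \<open>\<Gamma>\<close> (the first homology of the
  punctured torus); column one is the image of \<open>a\<close>, column two the image of \<open>b\<close>.\<close>

definition abel_matrix :: "(free2 \<Rightarrow> free2) \<Rightarrow> int^2^2"
  where "abel_matrix \<phi> = vector [vector [exp_sum GenA (\<phi> gen_a), exp_sum GenA (\<phi> gen_b)],
                                  vector [exp_sum GenB (\<phi> gen_a), exp_sum GenB (\<phi> gen_b)]]"

text \<open>By the Dehn--Nielsen theorem for the once-punctured torus, a mapping class \<open>H\<close> is the same as
  the class, modulo inner automorphisms, of its induced automorphism \<open>H\<^sub>*\<close> of \<open>\<Gamma>\<close>, and
  the automorphisms that occur are those preserving orientation, i.e. those acting on homology with
  determinant 1. Sending a class to its matrix identifies the group with \<open>SL(2, \<int>)\<close>.\<close>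

definition Aut_plus :: "(free2 \<Rightarrow> free2) monoid"
  where "Aut_plus = AutoGroup \<Gamma> \<lparr>carrier := {\<phi> \<in> auto \<Gamma>. det (abel_matrix \<phi>) = 1}\<rparr>"

definition Inn :: "(free2 \<Rightarrow> free2) set"
  where "Inn = {\<lambda>x. g \<otimes>\<^bsub>\<Gamma>\<^esub> x \<otimes>\<^bsub>\<Gamma>\<^esub> inv\<^bsub>\<Gamma>\<^esub> g | g. g \<in> carrier \<Gamma>}"

definition MCG :: "(free2 \<Rightarrow> free2) set monoid"
  where "MCG = Aut_plus Mod Inn"

text \<open>An element \<open>H\<close> of \<open>MCG\<close> is the set of all automorphisms representing it. Precomposing \<open>\<rho>\<close> with
  the different representatives gives exactly the conjugates of \<open>\<rho> \<circ> H\<^sub>*\<close> under \<open>\<rho> ` carrier \<Gamma>\<close>,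
  so letting both \<open>\<rho>\<close> and the representative vary gives the whole class \<open>[\<rho> \<circ> H\<^sub>*]\<close>.\<close>

definition mcg_act :: "(free2 \<Rightarrow> free2) set \<Rightarrow> (free2 \<Rightarrow> complex^2^2) set \<Rightarrow> (free2 \<Rightarrow> complex^2^2) set"
  where "mcg_act H c = {\<rho> \<circ> \<phi> | \<rho> \<phi>. \<rho> \<in> c \<and> \<phi> \<in> H}"

end

theory Submission
  imports Defs
begin

text \<open>
  Up to conjugation, every free basis of \<open>\<Gamma>\<close> arises from \<open>(a, b)\<close> by a signed permutation, a word
  in the two positive moves \<open>(u, v) \<mapsto> (u, u v)\<close> and \<open>(u, v) \<mapsto> (u v, v)\<close>, and another signed
  permutation (\<open>basis_standard\<close>, a form of Nielsen's theorem). A mapping class is determined by the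
  image of \<open>(a, b)\<close> up to conjugation, so it is determined by such data (\<open>coded_by_unique\<close>), and it
  is enough to bound the words. If \<open>H\<close> sends a point of \<open>K\<close> into \<open>K\<close>, then the traces of the basis
  that codes \<open>H\<close> are bounded by a constant that depends on \<open>K\<close> only.

  On traces the positive moves become polynomial maps of the cubic surface: a triple \<open>(x, y, z)\<close>
  goes to \<open>(x, z, x z - y)\<close> or to \<open>(z, y, z y - x)\<close>. Words are the vertices of a rooted binary tree,
  and each vertex introduces one new trace, that of a new simple closed curve. What has to be shown
  is that, locally uniformly in the triple, only finitely many words lead to a triple bounded by a
  given constant \<open>M\<close> (\<open>finite_bounded_words\<close>). Call a triple escaping if this holds near it. A triple
  is escaping as soon as both of its successors are; hence from a triple that is not escaping one can
  follow an infinite path of triples that are not escaping. Such a path contradicts the BQ-conditions: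

  \<^item> As soon as \<open>|x|, |y| > 2\<close> and \<open>|z| > |x|, |y|\<close>, all traces further on grow exponentially,
    at a rate that is uniform nearby (\<open>escapes_if_cone\<close>).

  \<^item> If the path eventually keeps one entry \<open>x = \<lambda> + 1/\<lambda>\<close> forever, it follows the boundary of one
    complementary region of the tree. The other traces there are \<open>A \<lambda>\<^sup>n + B \<lambda>\<^sup>-\<^sup>n\<close> with \<open>|\<lambda>| > 1\<close>,
    by (BQ1). If \<open>A = 0\<close> they tend to \<open>0\<close>, which contradicts (BQ2); otherwise they grow
    exponentially and so do the traces on all branches that leave the boundary
    (\<open>BQ_escapes_along_constant\<close>).

  \<^item> Otherwise, by (BQ2), all traces on the path eventually exceed \<open>2\<close> in modulus, and since no
    triple is in the situation of the first item, the path always discards the largest entry. The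
    moduli then decrease to a common limit, which must be \<open>2\<close>, and at the turns of the path the
    triples approach \<open>(\<plusminus>2, \<plusminus>2, \<plusminus>2)\<close> with product \<open>8\<close>. There \<open>x\<^sup>2 + y\<^sup>2 + z\<^sup>2 - x y z = 4\<close>, but this
    polynomial is constantly \<open>\<tau> + 2 \<noteq> 4\<close> (\<open>impossible\<close>).
\<close>

section \<open>Dynamics of trace triples\<close>

type_synonym state = "complex \<times> complex \<times> complex"

text \<open>The entries \<open>x\<close>, \<open>y\<close>, \<open>z\<close> stand for the traces of \<open>u\<close>, \<open>v\<close>, \<open>u v\<close>, where \<open>(u, v)\<close> is a free
  basis; \<open>step\<close> is the effect of replacing \<open>v\<close> (for \<open>True\<close>) or \<open>u\<close> (for \<open>False\<close>) by \<open>u v\<close>. The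
  third entry is the only new one after a step, and it belongs to the region in front of the
  corresponding edge of the tree.\<close>

fun step :: "bool \<Rightarrow> state \<Rightarrow> state" where
  "step True (x, y, z) = (x, z, x * z - y)"
| "step False (x, y, z) = (z, y, z * y - x)"

definition run :: "bool list \<Rightarrow> state \<Rightarrow> state"
  where "run w s = fold step w s"

lemma run_simps [simp]:
  "run [] s = s" "run (l # w) s = run w (step l s)" "run (v @ w) s = run w (run v s)"
  by (simp_all add: run_def)

fun front :: "state \<Rightarrow> complex" where
  "front (x, y, z) = z"

fun bounded_by :: "real \<Rightarrow> state \<Rightarrow> bool" where
  "bounded_by M (x, y, z) \<longleftrightarrow> cmod x \<le> M \<and> cmod y \<le> M \<and> cmod z \<le> M"

text \<open>For the trace triple of a representation this invariant is \<open>\<tau> + 2\<close>, by Fricke's identity for the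
  trace of a commutator.\<close>

fun kappa :: "state \<Rightarrow> complex" where
  "kappa (x, y, z) = x\<^sup>2 + y\<^sup>2 + z\<^sup>2 - x * y * z"

lemma kappa_step [simp]: "kappa (step l s) = kappa s"
  by (cases s; cases l) (auto simp: power2_eq_square algebra_simps)

lemma kappa_run [simp]: "kappa (run w s) = kappa s"
  by (induction w arbitrary: s) auto

text \<open>The BQ-conditions for the curves that occur beyond one edge of the tree, together with
  \<open>\<tau> \<noteq> 2\<close>. Distinct words have distinct front curves, so counting words in the last clause amounts
  to counting curves.\<close>

definition BQ_state :: "state \<Rightarrow> bool" where
  "BQ_state s \<longleftrightarrow> kappa s \<noteq> 4
     \<and> (\<forall>w x y z. run w s = (x, y, z) \<longrightarrow> x \<notin> complex_of_real ` {-2..2} \<and> y \<notin> complex_of_real ` {-2..2})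
     \<and> finite {w. cmod (front (run w s)) \<le> 2}"

definition escapes :: "real \<Rightarrow> state \<Rightarrow> bool" where
  "escapes M s \<longleftrightarrow> (\<exists>U N. open U \<and> s \<in> U \<and>
     (\<forall>t\<in>U. \<forall>w. N \<le> length w \<longrightarrow> \<not> bounded_by M (run w t)))"

lemma continuous_step: "continuous_on UNIV (step l)"
proof -
  have "step True = (\<lambda>s. (fst s, snd (snd s), fst s * snd (snd s) - fst (snd s)))"
    "step False = (\<lambda>s. (snd (snd s), fst (snd s), snd (snd s) * fst (snd s) - fst s))"
    by auto
  then show ?thesis
    by (cases l) (auto intro!: continuous_intros)
qed

text \<open>A word that is not empty starts with one of the two steps; pulling back the two neighbourhoods along
  the continuous maps \<open>step True\<close> and \<open>step False\<close> costs one letter.\<close>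

lemma escapes_if_both:
  assumes "escapes M (step True s)" "escapes M (step False s)"
  shows "escapes M s"
proof -
  obtain U1 N1 where 1: "open U1" "step True s \<in> U1"
      "\<And>t w. t \<in> U1 \<Longrightarrow> N1 \<le> length w \<Longrightarrow> \<not> bounded_by M (run w t)"
    using assms(1) unfolding escapes_def by blast
  obtain U2 N2 where 2: "open U2" "step False s \<in> U2"
      "\<And>t w. t \<in> U2 \<Longrightarrow> N2 \<le> length w \<Longrightarrow> \<not> bounded_by M (run w t)"
    using assms(2) unfolding escapes_def by blast
  let ?U = "step True -` U1 \<inter> step False -` U2"
  have "open ?U"
    by (intro open_Int open_vimage 1 2 continuous_step)
  moreover have "\<not> bounded_by M (run w t)" if "t \<in> ?U" "Suc (max N1 N2) \<le> length w" for t w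
  proof (cases w)
    case (Cons l v)
    then show ?thesis using that 1(3)[of "step True t" v] 2(3)[of "step False t" v]
      by (cases l) auto
  qed (use that in auto)
  ultimately show ?thesis
    unfolding escapes_def using 1(2) 2(2) by (intro exI[of _ ?U] exI[of _ "Suc (max N1 N2)"]) auto
qed

text \<open>The triples in which the front entry dominates two entries of modulus larger than \<open>1 + k\<close>. For
  \<open>k \<ge> 1\<close> the set is closed under both steps, since the new entry satisfies
  \<open>|x z - y| \<ge> |x| |z| - |y| > (1 + k) |z| - |z|\<close>; this also gives the growth by the factor \<open>k\<close>.\<close>

definition growth_cone :: "real \<Rightarrow> state set" where
  "growth_cone k = {(x, y, z). 1 + k < cmod x \<and> 1 + k < cmod y \<and> cmod x < cmod z \<and> cmod y < cmod z}"

lemma growth_cone_step: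
  assumes "s \<in> growth_cone k" "1 \<le> k"
  shows "step l s \<in> growth_cone k" "k * cmod (front s) < cmod (front (step l s))"
proof -
  obtain x y z where s: "s = (x, y, z)" by (cases s)
  have c: "1 + k < cmod x" "1 + k < cmod y" "cmod x < cmod z" "cmod y < cmod z"
    using assms by (auto simp: s growth_cone_def)
  have *: "k * cmod z < cmod (p * z - q)" if "1 + k < cmod p" "cmod q < cmod z" for p q
  proof -
    have "(1 + k) * cmod z \<le> cmod p * cmod z"
      using that by (intro mult_right_mono) auto
    also have "\<dots> \<le> cmod (p * z - q) + cmod q"
      using norm_triangle_sub[of "p * z" q] by (simp add: norm_mult)
    finally show ?thesis using that by (simp add: algebra_simps)
  qed
  have "cmod z \<le> k * cmod z"
    using mult_right_mono[OF assms(2), of "cmod z"] by simp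
  then show "step l s \<in> growth_cone k" "k * cmod (front s) < cmod (front (step l s))"
    using c *[of x y] *[of y x] by (cases l; auto simp: s growth_cone_def mult.commute)+
qed

lemma unbounded_if_front: "M < cmod (front s) \<Longrightarrow> \<not> bounded_by M s"
  by (cases s) auto

lemma open_growth_cone: "open (growth_cone k)"
proof -
  have "growth_cone k = {s. 1 + k < cmod (fst s) \<and> 1 + k < cmod (fst (snd s)) \<and>
      cmod (fst s) < cmod (snd (snd s)) \<and> cmod (fst (snd s)) < cmod (snd (snd s))}"
    by (auto simp: growth_cone_def)
  then show ?thesis
    by (simp only:) (intro open_Collect_conj open_Collect_less continuous_intros)
qed

text \<open>Growth by a fixed factor \<open>k > 1\<close> at each step makes the front entry exceed any bound after a
  number of steps that depends on the bound and on \<open>k\<close> only. The set \<open>U\<close> may leak into the cone,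
  where growth continues: this covers the triples along the boundary of a region, whose side branches
  enter the cone.\<close>

lemma escapes_if_growing:
  assumes "open U" "s \<in> U" "1 < k"
    and "\<And>t. t \<in> U \<Longrightarrow> 1 \<le> cmod (front t)"
    and "\<And>t l. t \<in> U \<Longrightarrow> step l t \<in> U \<union> growth_cone k"
    and "\<And>t l. t \<in> U \<Longrightarrow> k * cmod (front t) \<le> cmod (front (step l t))"
  shows "escapes M s"
proof -
  have step: "step l t \<in> U \<union> growth_cone k \<and> k * cmod (front t) \<le> cmod (front (step l t))"
    if "t \<in> U \<union> growth_cone k" for t l
  proof (cases "t \<in> U")
    case False
    then show ?thesis using that assms(3) growth_cone_step[of t k l] by simp
  qed (use assms(5,6)[of t l] in simp)
  have run: "run w t \<in> U \<union> growth_cone k \<and> k ^ length w * cmod (front t) \<le> cmod (front (run w t))"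
    if "t \<in> U \<union> growth_cone k" for t w
    using that
  proof (induction w arbitrary: t)
    case (Cons l w)
    have "k ^ length (l # w) * cmod (front t) = k ^ length w * (k * cmod (front t))"
      by simp
    also have "\<dots> \<le> k ^ length w * cmod (front (step l t))"
      using step[OF Cons.prems] assms(3) by (intro mult_left_mono) auto
    also have "\<dots> \<le> cmod (front (run (l # w) t))"
      using Cons.IH[of "step l t"] step[OF Cons.prems] by auto
    finally show ?case using Cons.IH[of "step l t"] step[OF Cons.prems] by auto
  qed auto
  obtain N where N: "M < k ^ N"
    using real_arch_pow[OF assms(3)] by blast
  have "\<not> bounded_by M (run w t)" if "t \<in> U" "N \<le> length w" for t w
  proof (rule unbounded_if_front)
    have "M < k ^ length w"
      using N power_increasing[OF that(2), of k] assms(3) by linarith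
    also have "\<dots> \<le> k ^ length w * cmod (front t)"
      using assms(3,4) that(1) mult_left_mono[of 1 "cmod (front t)" "k ^ length w"] by simp
    finally show "M < cmod (front (run w t))"
      using run[of t w] that by simp
  qed
  then show ?thesis
    unfolding escapes_def using assms(1,2) by blast
qed

lemma escapes_if_cone:
  assumes "s \<in> growth_cone 1"
  shows "escapes M s"
proof -
  obtain x y z where s: "s = (x, y, z)" by (cases s)
  have c: "2 < cmod x" "2 < cmod y" "cmod x < cmod z" "cmod y < cmod z"
    using assms by (auto simp: s growth_cone_def)
  (* any k > 1 with 1 + k < |x|, |y| will do; m / 2 + 1 < m for m > 2 *)
  define k where "k = (min (cmod x) (cmod y)) / 2"
  have k: "1 < k" "s \<in> growth_cone k"
    using c by (auto simp: k_def s growth_cone_def min_def)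
  show ?thesis
    using k growth_cone_step[of _ k] by (intro escapes_if_growing[OF open_growth_cone, of s k])
      (auto simp: growth_cone_def less_imp_le)
qed

text \<open>The two roots of \<open>l\<^sup>2 - x l + 1\<close> have product \<open>1\<close>; if they have modulus \<open>1\<close> they are conjugate and
  their sum \<open>x\<close> lies in \<open>[-2, 2]\<close>.\<close>

lemma joukowski:
  assumes "x \<notin> complex_of_real ` {-2..2}"
  obtains l where "x = l + inverse l" "1 < cmod l"
proof -
  define l where "l = (x + csqrt (x\<^sup>2 - 4)) / 2"
  have "l * (x - l) = 1"
    using power2_csqrt[of "x\<^sup>2 - 4"] unfolding l_def
    by (simp add: field_simps power2_eq_square)
  then have l: "l \<noteq> 0" "x = l + inverse l"
    by (auto simp: inverse_unique)
  have "cmod l \<noteq> 1"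
  proof
    assume 1: "cmod l = 1"
    then have "inverse l = cnj l"
      by (metis complex_norm_square inverse_unique of_real_1 power_one)
    then have "x = complex_of_real (2 * Re l)"
      using l(2) complex_add_cnj[of l] by simp
    moreover have "\<bar>Re l\<bar> \<le> 1" using abs_Re_le_cmod[of l] 1 by simp
    ultimately show False
      using assms
      by (metis (no_types, opaque_lifting) image_eqI abs_le_iff atLeastAtMost_iff mult_2 add_mono
          one_add_one minus_add_distrib neg_le_iff_le minus_le_iff)
  qed
  moreover have "x = inverse l + inverse (inverse l)" "cmod (inverse l) = inverse (cmod l)"
    using l by (auto simp: norm_inverse)
  ultimately show ?thesis
    using that[of l] that[of "inverse l"] l
    by (metis linorder_neqE_linordered_idom norm_eq_zero one_less_inverse_iff zero_less_norm_iff)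
qed

text \<open>Steps that keep the entry \<open>x\<close> act on the ratio \<open>z / y\<close> of the other two by the Moebius
  transformation \<open>r \<mapsto> x - 1 / r\<close>, of which \<open>l\<close> is the attracting fixed point. Hence the condition that
  the ratio be \<open>e\<close>-close to \<open>l\<close> propagates along the boundary, also if \<open>x\<close> is perturbed slightly
  while \<open>l\<close> is kept, and it makes the entries grow by the factor \<open>|l| - e > 1\<close>. Once both of them are
  larger than \<open>4 + |x|\<close>, every branch that leaves the boundary starts in the growth cone.\<close>

lemma escapes_along_boundary:
  assumes x: "x = l + inverse l" "1 < cmod l"
    and small: "cmod (z - l * y) < e * cmod y" "0 < e" "e < cmod l - 1"
    and big: "4 + cmod x < cmod y"
  shows "escapes M (x, y, z)"
proof -
  (* the room that the contraction by 1 / |l| leaves for a perturbation of x *)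
  define d where "d = e * (1 - inverse (cmod l))"
  define B where "B = 4 + cmod x"
  define U where "U = {(p, q, r). cmod (p - x) < min d 1 \<and> cmod (r - l * q) < e * cmod q \<and> B < cmod q}"
  (* growth is at least |l| - e along the boundary and at least 3 into a branch; the bound 2 keeps 1 + k below the entries when a branch enters the cone *)
  define k where "k = min 2 (cmod l - e)"
  have il: "0 < inverse (cmod l)" "inverse (cmod l) < 1"
    using x(2) by (auto simp: inverse_less_1_iff)
  have d: "0 < d"
    using il small(2) by (simp add: d_def)
  have k: "1 < k" "k \<le> cmod l - e" "k \<le> 2"
    using small(3) by (auto simp: k_def)
  have U: "k * cmod q \<le> cmod r" "B < cmod q" "cmod q < cmod r" "cmod p < B - 3"
    if "(p, q, r) \<in> U" for p q r
  proof -
    have *: "cmod (r - l * q) < e * cmod q" "B < cmod q" "cmod (p - x) < 1"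
      using that by (auto simp: U_def)
    have "k * cmod q \<le> (cmod l - e) * cmod q"
      using k by (intro mult_right_mono) auto
    also have "\<dots> = cmod (l * q) - e * cmod q"
      by (simp add: norm_mult algebra_simps)
    also have "\<dots> \<le> cmod r"
      using *(1) norm_triangle_ineq2[of "l * q" r] by (simp add: norm_minus_commute)
    finally show 1: "k * cmod q \<le> cmod r" .
    show "B < cmod q" by fact
    then have "0 < cmod q"
      unfolding B_def by (smt (verit) norm_ge_zero)
    then have "cmod q < k * cmod q" using k by simp
    then show "cmod q < cmod r" using 1 by simp
    show "cmod p < B - 3"
      using *(3) norm_triangle_sub[of p x] by (simp add: B_def)
  qed
  have B: "4 \<le> B" by (simp add: B_def)
  show ?thesis
  proof (rule escapes_if_growing[of U _ k])
    have "U = {s. cmod (fst s - x) < min d 1 \<and>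
        cmod (snd (snd s) - l * fst (snd s)) < e * cmod (fst (snd s)) \<and> B < cmod (fst (snd s))}"
      by (auto simp: U_def)
    then show "open U"
      by (simp only:) (intro open_Collect_conj open_Collect_less continuous_intros)
    show "(x, y, z) \<in> U"
      using assms d by (auto simp: U_def B_def)
    fix t :: state and b
    assume t: "t \<in> U"
    obtain p q r where t_eq: "t = (p, q, r)" by (cases t)
    note Ut = U[OF t[unfolded t_eq]]
    show "1 \<le> cmod (front t)"
      using Ut B by (simp add: t_eq)
    have r: "0 < cmod r" using Ut B by linarith
    have U_step: "step True t \<in> U"
    proof -
      have "p * r - q - l * r = (p - x) * r + inverse l * (r - l * q)"
        using x(2) by (simp add: x(1) algebra_simps) (auto simp: field_simps)
      then have "cmod (p * r - q - l * r) \<le> cmod ((p - x) * r) + cmod (inverse l * (r - l * q))"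
        using norm_triangle_ineq by metis
      also have "\<dots> = cmod (p - x) * cmod r + inverse (cmod l) * cmod (r - l * q)"
        by (simp add: norm_mult norm_inverse)
      also have "\<dots> \<le> cmod (p - x) * cmod r + inverse (cmod l) * (e * cmod r)"
      proof -
        have "cmod (r - l * q) \<le> e * cmod q" using t by (auto simp: U_def t_eq)
        also have "\<dots> \<le> e * cmod r" using Ut(3) small(2) by simp
        finally show ?thesis using il(1) by (simp del: inverse_positive_iff_positive)
      qed
      also have "\<dots> < d * cmod r + inverse (cmod l) * (e * cmod r)"
        using t r by (auto simp: U_def t_eq)
      also have "\<dots> = e * cmod r" by (simp add: d_def algebra_simps)
      finally show ?thesis using t Ut by (auto simp: U_def t_eq)
    qed
    show "step b t \<in> U \<union> growth_cone k"
    proof (cases b)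
      case False
      have "4 * cmod r \<le> cmod q * cmod r"
        using Ut B by (intro mult_right_mono) auto
      then have "3 * cmod r < cmod (r * q - p)"
        using norm_triangle_ineq2[of "r * q" p] Ut by (simp add: norm_mult mult.commute)
      then show ?thesis
        using Ut B r k False unfolding t_eq growth_cone_def by simp
    qed (use U_step in auto)
    show "k * cmod (front t) \<le> cmod (front (step b t))"
    proof -
      have *: "k * cmod r \<le> cmod (u * r - v)" if "cmod v < cmod r" "3 \<le> cmod u" for u v
      proof -
        have "3 * cmod r \<le> cmod u * cmod r" using that by (intro mult_right_mono) auto
        moreover have "k * cmod r \<le> 2 * cmod r" using k by (intro mult_right_mono) auto
        ultimately show ?thesis
          using norm_triangle_ineq2[of "u * r" v] that by (simp add: norm_mult)
      qed
      show ?thesis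
      proof (cases b)
        case True
        then show ?thesis using U_step t by (auto simp: t_eq dest: U(1))
      next
        case False
        then show ?thesis using *[of p q] Ut B by (simp add: t_eq mult.commute)
      qed
    qed
  qed (use k in auto)
qed

text \<open>(BQ2) along a boundary: infinitely many distinct words would have a front entry of modulus at most
  \<open>2\<close>.\<close>

lemma run_replicate_infinite:
  assumes "BQ_state s"
  shows "\<not> (\<forall>n\<ge>N. cmod (front (run (replicate n b) s)) \<le> 2)"
proof
  assume *: "\<forall>n\<ge>N. cmod (front (run (replicate n b) s)) \<le> 2"
  have "inj_on (\<lambda>n. replicate n b) {N..}"
    by (rule inj_on_inverseI[of _ length]) simp
  moreover have "(\<lambda>n. replicate n b) ` {N..} \<subseteq> {w. cmod (front (run w s)) \<le> 2}"
    using * by auto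
  ultimately have "finite {N..}"
    using assms unfolding BQ_state_def by (metis (no_types, lifting) inj_on_finite)
  then show False using infinite_Ici by blast
qed

text \<open>Along the boundary of the region of \<open>x\<close> the other entries solve the recurrence
  \<open>f (n + 2) = x f (n + 1) - f n\<close>. The solution cannot decay, by (BQ2), so its growing component is
  non-zero; then far out consecutive entries are large with ratio close to \<open>l\<close>.\<close>

lemma BQ_escapes_along_True:
  assumes "BQ_state s"
  shows "\<exists>n. escapes M (run (replicate n True) s)"
proof -
  obtain x y z where s: "s = (x, y, z)" by (cases s)
  have "x \<notin> complex_of_real ` {-2..2}"
    using assms s unfolding BQ_state_def by (metis run_simps(1))
  then obtain l where l: "x = l + inverse l" "1 < cmod l"
    using joukowski by blast
  have l0: "l \<noteq> 0" and li: "l - inverse l \<noteq> 0"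
  proof -
    show "l \<noteq> 0" using l(2) by auto
    show "l - inverse l \<noteq> 0"
    proof
      assume "l - inverse l = 0"
      then have "cmod l = inverse (cmod l)" by (metis norm_inverse right_minus_eq)
      then show False using l(2) by (metis inverse_less_1_iff less_asym not_one_less_zero)
    qed
  qed
  (* coefficients of the solution A l^n + B l^-n with f 0 = y and f 1 = z *)
  define A where "A = (z - inverse l * y) / (l - inverse l)"
  define B where "B = y - A"
  define f where "f n = A * l ^ n + B * inverse l ^ n" for n
  have f0: "f 0 = y" by (simp add: f_def B_def)
  have f1: "f (Suc 0) = z"
  proof -
    have "f (Suc 0) = A * (l - inverse l) + inverse l * y"
      by (simp add: f_def B_def algebra_simps)
    then show ?thesis using li by (simp add: A_def)
  qed
  have f2: "f (Suc (Suc n)) = x * f (Suc n) - f n" for n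
    using l0 by (simp add: f_def l(1) field_simps)
  have run: "run (replicate n True) s = (x, f n, f (Suc n))" for n
  proof (induction n)
    case 0
    then show ?case by (simp add: s f0 f1)
  next
    case (Suc n)
    have "replicate (Suc n) True = replicate n True @ [True]"
      by (simp add: replicate_append_same)
    then show ?case by (simp only: run_simps Suc) (simp add: f2)
  qed
  have il: "cmod (inverse l) < 1"
    using l(2) by (simp add: norm_inverse inverse_less_1_iff)
  have B_lim: "(\<lambda>n. B * inverse l ^ n) \<longlonglongrightarrow> 0"
    using LIMSEQ_power_zero[OF il] tendsto_mult_right_zero by blast
  have "A \<noteq> 0"
  proof
    assume "A = 0"
    then have "(\<lambda>n. cmod (f (Suc n))) \<longlonglongrightarrow> 0"
      using B_lim LIMSEQ_Suc tendsto_norm_zero by (fastforce simp: f_def)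
    then have "eventually (\<lambda>n. cmod (f (Suc n)) < 2) sequentially"
      by (rule order_tendstoD) simp
    then obtain N where "\<forall>n\<ge>N. cmod (front (run (replicate n True) s)) \<le> 2"
      unfolding eventually_sequentially run by (auto intro: less_imp_le)
    then show False using run_replicate_infinite[OF assms] by blast
  qed
  define e where "e = (cmod l - 1) / 2"
  have e: "0 < e" "e < cmod l - 1" using l(2) by (auto simp: e_def)
  define C where "C = max (4 + cmod x) (cmod B * cmod (inverse l - l) / e)"
  obtain n where n: "(cmod B + C) / cmod A < cmod l ^ n"
    using real_arch_pow[OF l(2)] by blast
  have small: "cmod (inverse l ^ n) \<le> 1"
    using il by (simp add: norm_power power_le_one)
  have fn: "C < cmod (f n)"
  proof -
    have "cmod B + C < cmod (A * l ^ n)"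
      using n \<open>A \<noteq> 0\<close> by (simp add: norm_mult norm_power field_simps)
    moreover have "cmod (B * inverse l ^ n) \<le> cmod B"
      using mult_left_mono[OF small, of "cmod B"] by (simp add: norm_mult)
    ultimately show ?thesis
      using norm_diff_ineq[of "A * l ^ n" "B * inverse l ^ n"] by (simp add: f_def)
  qed
  have "cmod (f (Suc n) - l * f n) = cmod (B * (inverse l - l)) * cmod (inverse l ^ n)"
    unfolding norm_mult[symmetric] by (rule arg_cong[of _ _ cmod]) (simp add: f_def algebra_simps)
  also have "\<dots> \<le> cmod B * cmod (inverse l - l)"
    using mult_left_mono[OF small, of "cmod (B * (inverse l - l))"] by (simp add: norm_mult)
  also have "\<dots> \<le> e * C"
    using e(1) by (simp add: C_def field_simps max_def)
  also have "\<dots> < e * cmod (f n)"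
    using fn e by simp
  finally have "escapes M (x, f n, f (Suc n))"
    using escapes_along_boundary[OF l _ e] fn by (simp add: C_def)
  then show ?thesis using run by metis
qed

text \<open>Exchanging the first two entries exchanges the two steps; this transfers results about \<open>True\<close> to
  \<open>False\<close>.\<close>

fun swap :: "state \<Rightarrow> state" where
  "swap (x, y, z) = (y, x, z)"

lemma swap_simps [simp]:
  "swap (swap s) = s" "front (swap s) = front s" "kappa (swap s) = kappa s"
  "bounded_by M (swap s) = bounded_by M s" "step b (swap s) = swap (step (\<not> b) s)"
  by (cases s; cases b; auto)+

lemma run_swap: "run w (swap s) = swap (run (map Not w) s)"
  by (induction w arbitrary: s) auto

lemma escapes_swap:
  assumes "escapes M (swap s)"
  shows "escapes M s"
proof -
  obtain U N where U: "open U" "swap s \<in> U"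
      "\<And>t w. t \<in> U \<Longrightarrow> N \<le> length w \<Longrightarrow> \<not> bounded_by M (run w t)"
    using assms unfolding escapes_def by blast
  have eq: "swap = (\<lambda>s. (fst (snd s), fst s, snd (snd s)))" by auto
  have "continuous_on UNIV swap" by (subst eq) (intro continuous_intros)
  then have "open (swap -` U)" using U(1) open_vimage by blast
  moreover have "\<not> bounded_by M (run w t)" if "t \<in> swap -` U" "N \<le> length w" for w t
    using U(3)[of "swap t" "map Not w"] that by (simp add: run_swap comp_def)
  ultimately show ?thesis
    unfolding escapes_def using U(2) by blast
qed

lemma BQ_swap:
  assumes "BQ_state s"
  shows "BQ_state (swap s)"
proof -
  have "x \<notin> complex_of_real ` {-2..2} \<and> y \<notin> complex_of_real ` {-2..2}"
    if "run w (swap s) = (x, y, z)" for w x y z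
  proof -
    have "run (map Not w) s = swap (x, y, z)"
      using that by (metis run_swap swap_simps(1))
    then show ?thesis using assms unfolding BQ_state_def by (metis swap.simps)
  qed
  moreover have "finite {w. cmod (front (run w (swap s))) \<le> 2}"
  proof -
    have "{w. cmod (front (run w (swap s))) \<le> 2} = map Not -` {w. cmod (front (run w s)) \<le> 2}"
      by (auto simp: run_swap)
    moreover have "inj (map Not)" by (simp add: inj_def)
    ultimately show ?thesis
      using assms finite_vimageI unfolding BQ_state_def by metis
  qed
  ultimately show ?thesis
    using assms unfolding BQ_state_def by (metis swap_simps(3))
qed

lemma BQ_run:
  assumes "BQ_state s"
  shows "BQ_state (run v s)"
proof -
  have "{w. cmod (front (run w (run v s))) \<le> 2} = (@) v -` {w. cmod (front (run w s)) \<le> 2}"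
    by auto
  moreover have "inj ((@) v)" by (simp add: inj_def)
  ultimately have "finite {w. cmod (front (run w (run v s))) \<le> 2}"
    using assms finite_vimageI unfolding BQ_state_def by metis
  then show ?thesis
    using assms unfolding BQ_state_def by (metis kappa_run run_simps(3))
qed

lemma BQ_escapes_along_constant:
  assumes "BQ_state s"
  shows "\<exists>n. escapes M (run (replicate n b) s)"
proof (cases b)
  case True
  then show ?thesis using BQ_escapes_along_True[OF assms] by simp
next
  case False
  obtain n where "escapes M (run (replicate n True) (swap s))"
    using BQ_escapes_along_True[OF BQ_swap[OF assms]] by blast
  then have "escapes M (swap (run (replicate n False) s))"
    by (simp add: run_swap)
  then show ?thesis
    using False escapes_swap[of M "run (replicate n False) s"] by auto
qed

section \<open>Descending paths\<close>

text \<open>The infinite path that exists below a triple that does not escape; the aim of this section is to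
  refute it.\<close>

locale nonescaping_path =
  fixes M :: real and b :: "nat \<Rightarrow> bool" and X Y Z :: "nat \<Rightarrow> complex"
  assumes BQ: "BQ_state (X 0, Y 0, Z 0)"
    and step: "(X (Suc n), Y (Suc n), Z (Suc n)) = step (b n) (X n, Y n, Z n)"
    and not_escapes: "\<not> escapes M (X n, Y n, Z n)"
begin

lemma Suc_simps:
  "X (Suc n) = (if b n then X n else Z n)" "Y (Suc n) = (if b n then Z n else Y n)"
  "Z (Suc n) = (if b n then X n * Z n - Y n else Z n * Y n - X n)"
  using step[of n] by auto

lemma run_map: "run (map b [0..<n]) (X 0, Y 0, Z 0) = (X n, Y n, Z n)"
  by (induction n) (auto simp: Suc_simps)

lemma BQ_path: "BQ_state (X n, Y n, Z n)"
  using BQ_run[OF BQ, of "map b [0..<n]"] run_map by simp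

text \<open>A path that never turns again follows the boundary of a single region, along which the triples
  eventually escape.\<close>

lemma turns: "\<exists>m\<ge>n. b m = c"
proof (rule ccontr)
  assume "\<not> ?thesis"
  then have b: "b m = (\<not> c)" if "n \<le> m" for m using that by blast
  have "run (replicate k (\<not> c)) (X n, Y n, Z n) = (X (n + k), Y (n + k), Z (n + k))" for k
  proof (induction k)
    case (Suc k)
    have "replicate (Suc k) (\<not> c) = replicate k (\<not> c) @ [b (n + k)]"
      using b by (simp add: replicate_append_same)
    then show ?case by (simp only: run_simps Suc step[symmetric] add_Suc_right)
  qed simp
  then show False
    using BQ_escapes_along_constant[OF BQ_path[of n], of M "\<not> c"] not_escapes by auto
qed

text \<open>By (BQ2), since the prefixes of the path are distinct words.\<close>

lemma front_large: "\<exists>N. \<forall>n\<ge>N. 2 < cmod (Z n)"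
proof -
  have "inj (\<lambda>n. map b [0..<n])"
    by (rule inj_on_inverseI[of _ length]) simp
  moreover have "finite {w. cmod (front (run w (X 0, Y 0, Z 0))) \<le> 2}"
    using BQ by (simp add: BQ_state_def)
  ultimately have "finite ((\<lambda>n. map b [0..<n]) -` {w. cmod (front (run w (X 0, Y 0, Z 0))) \<le> 2})"
    by (rule finite_vimageI[rotated])
  then have "finite {n. cmod (Z n) \<le> 2}"
    by (simp add: vimage_def run_map)
  then obtain N where "\<forall>n\<in>{n. cmod (Z n) \<le> 2}. n < N"
    unfolding finite_nat_set_iff_bounded by blast
  then show ?thesis
    by (intro exI[of _ N]) (metis mem_Collect_eq not_le)
qed

text \<open>After each of the two steps has been taken once, all three entries have been front entries.\<close>

lemma all_large: "\<exists>N. \<forall>n\<ge>N. 2 < cmod (X n) \<and> 2 < cmod (Y n) \<and> 2 < cmod (Z n)"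
proof -
  obtain N where "\<forall>n\<ge>N. 2 < cmod (Z n)"
    using front_large by blast
  then have N: "2 < cmod (Z n)" if "N \<le> n" for n
    using that by simp
  obtain i j where ij: "N \<le> i" "\<not> b i" "N \<le> j" "b j"
    using turns[of N True] turns[of N False] by auto
  have "2 < cmod (X n)" if "Suc i \<le> n" for n
    using that by (induction n rule: dec_induct) (use N ij in \<open>auto simp: Suc_simps\<close>)
  moreover have "2 < cmod (Y n)" if "Suc j \<le> n" for n
    using that by (induction n rule: dec_induct) (use N ij in \<open>auto simp: Suc_simps\<close>)
  moreover have "2 < cmod (Z n)" if "Suc i \<le> n" for n
    using N[of n] that ij(1) by linarith
  ultimately have "\<forall>n\<ge>max (Suc i) (Suc j). 2 < cmod (X n) \<and> 2 < cmod (Y n) \<and> 2 < cmod (Z n)"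
    by (simp only: max.bounded_iff) simp
  then show ?thesis ..
qed

text \<open>The entry of the region behind the edge, across from the front entry \<open>Z n\<close>; the two add up to
  \<open>X n * Y n\<close>.\<close>

definition W :: "nat \<Rightarrow> complex" where "W n = X n * Y n - Z n"

lemma W_Suc: "W (Suc n) = (if b n then Y n else X n)"
  by (simp add: W_def Suc_simps)

text \<open>The path descends: outside the growth cone the front entry does not dominate, and as
  \<open>|Z + W| = |X| |Y| > 2 max(|X|, |Y|)\<close>, the entry behind has to be the largest of the four.\<close>

lemma back_dominates:
  assumes "2 < cmod (X n)" "2 < cmod (Y n)"
  shows "cmod (X n) < cmod (W n)" "cmod (Y n) < cmod (W n)" "cmod (Z n) < cmod (W n)"
proof -
  have "(X n, Y n, Z n) \<notin> growth_cone 1"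
    using not_escapes escapes_if_cone by blast
  then have Z: "cmod (Z n) \<le> max (cmod (X n)) (cmod (Y n))"
    using assms by (auto simp: growth_cone_def)
  have "cmod (X n) * cmod (Y n) \<le> cmod (W n) + cmod (Z n)"
    using norm_triangle_ineq[of "W n" "Z n"] by (simp add: W_def norm_mult)
  moreover have "2 * cmod (Y n) < cmod (X n) * cmod (Y n)"
    using assms by (intro mult_strict_right_mono) auto
  moreover have "cmod (X n) * 2 < cmod (X n) * cmod (Y n)"
    using assms by (intro mult_strict_left_mono) auto
  ultimately show "cmod (X n) < cmod (W n)" "cmod (Y n) < cmod (W n)" "cmod (Z n) < cmod (W n)"
    using Z by linarith+
qed

text \<open>Each entry is at some later time the one behind the edge, and the moduli of those decrease
  to a limit \<open>m \<ge> 2\<close>. So all moduli tend to \<open>m\<close>, and \<open>|X| |Y| \<le> |Z| + |W|\<close> gives \<open>m\<^sup>2 \<le> 2 m\<close>.\<close>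

lemma limits:
  "(\<lambda>n. cmod (X n)) \<longlonglongrightarrow> 2" "(\<lambda>n. cmod (Y n)) \<longlonglongrightarrow> 2"
  "(\<lambda>n. cmod (Z n)) \<longlonglongrightarrow> 2" "(\<lambda>n. cmod (W n)) \<longlonglongrightarrow> 2"
proof -
  obtain N where "\<forall>n\<ge>N. 2 < cmod (X n) \<and> 2 < cmod (Y n) \<and> 2 < cmod (Z n)"
    using all_large by blast
  then have N: "2 < cmod (X n)" "2 < cmod (Y n)" "2 < cmod (Z n)" if "N \<le> n" for n
    using that by auto
  have dom: "cmod (X n) < cmod (W n)" "cmod (Y n) < cmod (W n)" "cmod (Z n) < cmod (W n)"
    if "N \<le> n" for n
    using back_dominates[OF N(1,2)[OF that]] by simp_all
  have "cmod (W (Suc n + N)) \<le> cmod (W (n + N))" for n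
    using dom(1,2)[of "n + N"] by (simp add: W_Suc)
  then have dec: "decseq (\<lambda>n. cmod (W (n + N)))"
    by (rule decseq_SucI)
  have "2 \<le> cmod (W (n + N))" for n
    using N(1)[of "n + N"] dom(1)[of "n + N"] by simp
  then obtain m where m: "(\<lambda>n. cmod (W (n + N))) \<longlonglongrightarrow> m" "\<forall>n. m \<le> cmod (W (n + N))"
    using decseq_convergent[OF dec] by blast
  have W: "(\<lambda>n. cmod (W n)) \<longlonglongrightarrow> m"
    by (rule LIMSEQ_offset[OF m(1)])
  have mW: "m \<le> cmod (W n)" if "N \<le> n" for n
    using m(2)[rule_format, of "n - N"] that by simp
  have mX: "m \<le> cmod (X n)" if n: "N \<le> n" for n
  proof -
    obtain k where k: "n \<le> k" "\<not> b k" using turns[of n False] by auto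
    have "N \<le> j \<Longrightarrow> m \<le> cmod (X j)" if "j \<le> k" for j
      using that
    proof (induction j rule: inc_induct)
      case base
      then show ?case using mW[of "Suc k"] k by (simp add: W_Suc)
    next
      case (step j)
      then show ?case using mW[of "Suc j"] by (cases "b j") (auto simp: W_Suc Suc_simps)
    qed
    then show ?thesis using k n by blast
  qed
  have mY: "m \<le> cmod (Y n)" if n: "N \<le> n" for n
  proof -
    obtain k where k: "n \<le> k" "b k" using turns[of n True] by auto
    have "N \<le> j \<Longrightarrow> m \<le> cmod (Y j)" if "j \<le> k" for j
      using that
    proof (induction j rule: inc_induct)
      case base
      then show ?case using mW[of "Suc k"] k by (simp add: W_Suc)
    next
      case (step j)
      then show ?case using mW[of "Suc j"] by (cases "b j") (auto simp: W_Suc Suc_simps)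
    qed
    then show ?thesis using k n by blast
  qed
  have mZ: "m \<le> cmod (Z n)" if n: "N \<le> n" for n
    using mX[of "Suc n"] mY[of "Suc n"] n by (cases "b n") (auto simp: Suc_simps)
  have lim: "(\<lambda>n. cmod (V n)) \<longlonglongrightarrow> m"
    if "\<And>n. N \<le> n \<Longrightarrow> m \<le> cmod (V n)" "\<And>n. N \<le> n \<Longrightarrow> cmod (V n) \<le> cmod (W n)" for V
    by (rule real_tendsto_sandwich[OF _ _ tendsto_const W])
      (use that in \<open>auto intro: eventually_sequentiallyI\<close>)
  have X: "(\<lambda>n. cmod (X n)) \<longlonglongrightarrow> m" by (rule lim[OF mX less_imp_le[OF dom(1)]])
  have Y: "(\<lambda>n. cmod (Y n)) \<longlonglongrightarrow> m" by (rule lim[OF mY less_imp_le[OF dom(2)]])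
  have Z: "(\<lambda>n. cmod (Z n)) \<longlonglongrightarrow> m" by (rule lim[OF mZ less_imp_le[OF dom(3)]])
  have "m * m \<le> m + m"
  proof (rule LIMSEQ_le[OF tendsto_mult[OF X Y] tendsto_add[OF W Z]])
    have "cmod (X n) * cmod (Y n) \<le> cmod (W n) + cmod (Z n)" for n
      using norm_triangle_ineq[of "W n" "Z n"] by (simp add: W_def norm_mult)
    then show "\<exists>N. \<forall>n\<ge>N. cmod (X n) * cmod (Y n) \<le> cmod (W n) + cmod (Z n)" by blast
  qed
  moreover have "2 \<le> m"
    by (rule LIMSEQ_le_const[OF X]) (use N(1) less_imp_le in blast)
  moreover have "m \<le> 2" if "m * m \<le> 2 * m"
    using that mult_right_less_imp_less[of m 2 m] \<open>2 \<le> m\<close> by (simp add: mult_le_cancel_right)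
  ultimately have "m = 2" by simp
  then show "(\<lambda>n. cmod (X n)) \<longlonglongrightarrow> 2" "(\<lambda>n. cmod (Y n)) \<longlonglongrightarrow> 2"
    "(\<lambda>n. cmod (Z n)) \<longlonglongrightarrow> 2" "(\<lambda>n. cmod (W n)) \<longlonglongrightarrow> 2"
    using X Y Z W by simp_all
qed

text \<open>As \<open>Z + W = X Y\<close>, the difference \<open>D\<close> is also \<open>2 Z - X Y\<close>: it measures how far the triple is from
  satisfying \<open>2 z = x y\<close>.\<close>

definition D :: "nat \<Rightarrow> complex" where "D n = Z n - W n"

text \<open>By the parallelogram law \<open>|Z - W|\<^sup>2 = 2 |Z|\<^sup>2 + 2 |W|\<^sup>2 - |Z + W|\<^sup>2\<close>, which tends to
  \<open>8 + 8 - 16\<close>.\<close>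

lemma D_lim: "(\<lambda>n. cmod (D n)) \<longlonglongrightarrow> 0"
proof -
  have "(cmod (D n))\<^sup>2 = 2 * (cmod (Z n))\<^sup>2 + 2 * (cmod (W n))\<^sup>2 - (cmod (X n) * cmod (Y n))\<^sup>2" for n
  proof -
    have "(cmod (Z n - W n))\<^sup>2 + (cmod (Z n + W n))\<^sup>2 = 2 * (cmod (Z n))\<^sup>2 + 2 * (cmod (W n))\<^sup>2"
      unfolding cmod_power2 minus_complex.sel plus_complex.sel
      by (simp add: power2_eq_square algebra_simps)
    moreover have "Z n + W n = X n * Y n" by (simp add: W_def)
    ultimately show ?thesis by (simp add: D_def norm_mult)
  qed
  moreover have "(\<lambda>n. 2 * (cmod (Z n))\<^sup>2 + 2 * (cmod (W n))\<^sup>2 - (cmod (X n) * cmod (Y n))\<^sup>2)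
      \<longlonglongrightarrow> 2 * 2\<^sup>2 + 2 * 2\<^sup>2 - (2 * 2)\<^sup>2"
    by (intro tendsto_intros limits)
  ultimately have "(\<lambda>n. (cmod (D n))\<^sup>2) \<longlonglongrightarrow> 0"
    by simp
  then have "(\<lambda>n. sqrt ((cmod (D n))\<^sup>2)) \<longlonglongrightarrow> sqrt 0"
    by (rule tendsto_real_sqrt)
  then show ?thesis by simp
qed

text \<open>Where the path turns, three consecutive defects \<open>a, b, c\<close> bound the distance of the triple from
  the equations \<open>2 z = x y\<close>, \<open>2 y = x z\<close>, \<open>2 x = y z\<close> at once. The exact solutions with \<open>x y \<noteq> 0\<close>
  have \<open>x\<^sup>2 = y\<^sup>2 = 4\<close> and \<open>kappa = 4\<close>. Quantitatively, \<open>4 (kappa - 4) = a\<^sup>2 - (4 - x\<^sup>2) (4 - y\<^sup>2)\<close>,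
  \<open>y (4 - x\<^sup>2) = x a - 2 b\<close> and \<open>x (4 - y\<^sup>2) = y a - 2 c + 2 b z\<close>.\<close>

lemma turn_identity:
  assumes "b n" "\<not> b (Suc n)"
  shows "4 * (kappa (X n, Y n, Z n) - 4) * (X n * Y n) =
    (D n)\<^sup>2 * (X n * Y n)
      - (X n * D n - 2 * D (Suc n)) * (Y n * D n - 2 * D (Suc (Suc n)) + 2 * D (Suc n) * Z n)"
proof -
  have D: "D n = 2 * Z n - X n * Y n" "D (Suc n) = X n * Z n - 2 * Y n"
    "D (Suc (Suc n)) = (X n * Z n - Y n) * Z n - 2 * X n"
    using assms by (simp_all add: D_def W_def Suc_simps)
  show ?thesis
    unfolding D kappa.simps by (simp add: power2_eq_square algebra_simps)
qed

text \<open>In \<open>turn_identity\<close> the right-hand side tends to \<open>0\<close>, because the entries are bounded and the defects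
  tend to \<open>0\<close>; the left-hand side tends to \<open>16 |kappa - 4| > 0\<close> in modulus. There are infinitely many turns.\<close>

lemma impossible: False
proof -
  let ?k = "kappa (X 0, Y 0, Z 0)"
  have k: "kappa (X n, Y n, Z n) = ?k" for n
    using kappa_run[of "map b [0..<n]" "(X 0, Y 0, Z 0)"] by (simp only: run_map)
  (* the triangle inequality applied to the right-hand side of the identity at a turn *)
  define H where "H n = (cmod (D n))\<^sup>2 * (cmod (X n) * cmod (Y n))
     + (cmod (X n) * cmod (D n) + 2 * cmod (D (Suc n)))
       * (cmod (Y n) * cmod (D n) + 2 * cmod (D (Suc (Suc n))) + 2 * cmod (D (Suc n)) * cmod (Z n))" for n
  note D1 = LIMSEQ_Suc[OF D_lim]
  note D2 = LIMSEQ_Suc[OF D1]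
  have "H \<longlonglongrightarrow> 0\<^sup>2 * (2 * 2) + (2 * 0 + 2 * 0) * (2 * 0 + 2 * 0 + 2 * 0 * 2)"
    unfolding H_def by (intro tendsto_intros limits D_lim D1 D2)
  moreover have "(\<lambda>n. 4 * cmod (?k - 4) * (cmod (X n) * cmod (Y n))) \<longlonglongrightarrow> 4 * cmod (?k - 4) * (2 * 2)"
    by (intro tendsto_intros limits)
  ultimately have "(\<lambda>n. 4 * cmod (?k - 4) * (cmod (X n) * cmod (Y n)) - H n) \<longlonglongrightarrow> 4 * cmod (?k - 4) * (2 * 2) - 0"
    by (intro tendsto_diff) simp_all
  moreover have "0 < 4 * cmod (?k - 4) * (2 * 2) - (0::real)"
    using BQ by (simp add: BQ_state_def)
  ultimately have "eventually (\<lambda>n. 0 < 4 * cmod (?k - 4) * (cmod (X n) * cmod (Y n)) - H n) sequentially"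
    by (rule order_tendstoD)
  then obtain N where "\<forall>n\<ge>N. 0 < 4 * cmod (?k - 4) * (cmod (X n) * cmod (Y n)) - H n"
    unfolding eventually_sequentially by blast
  then have N: "H n < 4 * cmod (?k - 4) * (cmod (X n) * cmod (Y n))" if "N \<le> n" for n
    using that by (simp only: diff_gt_0_iff_gt)
  obtain i where i: "N \<le> i" "b i" using turns[of N True] by auto
  have "\<exists>n\<ge>N. b n \<and> \<not> b (Suc n)"
  proof (rule ccontr)
    assume *: "\<not> ?thesis"
    have "b j" if "i \<le> j" for j
      using that by (induction rule: dec_induct) (use * i in auto)
    then show False using turns[of i False] by auto
  qed
  then obtain n where n: "N \<le> n" "b n" "\<not> b (Suc n)" by blast
  have "4 * cmod (?k - 4) * (cmod (X n) * cmod (Y n)) = cmod (4 * (?k - 4) * (X n * Y n))"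
    by (simp only: norm_mult norm_numeral)
  also have "\<dots> \<le> H n"
  proof -
    let ?a = "X n * D n - 2 * D (Suc n)"
    let ?c = "Y n * D n - 2 * D (Suc (Suc n)) + 2 * D (Suc n) * Z n"
    have "cmod ?a \<le> cmod (X n) * cmod (D n) + 2 * cmod (D (Suc n))"
      using norm_triangle_ineq4[of "X n * D n" "2 * D (Suc n)"] by (simp add: norm_mult)
    moreover have "cmod ?c \<le> cmod (Y n) * cmod (D n) + 2 * cmod (D (Suc (Suc n))) + 2 * cmod (D (Suc n)) * cmod (Z n)"
      using norm_triangle_ineq4[of "Y n * D n" "2 * D (Suc (Suc n))"]
        norm_triangle_ineq[of "Y n * D n - 2 * D (Suc (Suc n))" "2 * D (Suc n) * Z n"]
      by (simp add: norm_mult)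
    ultimately have "cmod ?a * cmod ?c \<le> H n - (cmod (D n))\<^sup>2 * (cmod (X n) * cmod (Y n))"
      unfolding H_def add_diff_cancel_left' by (rule mult_mono) simp_all
    then have "cmod ((D n)\<^sup>2 * (X n * Y n) - ?a * ?c) \<le> H n"
      using norm_triangle_ineq4[of "(D n)\<^sup>2 * (X n * Y n)" "?a * ?c"]
      by (simp add: norm_mult norm_power)
    then show ?thesis
      by (simp only: turn_identity[OF n(2,3)] flip: k[of n])
  qed
  finally show False using N[OF n(1)] by simp
qed

end

text \<open>A triple that does not escape has a successor that does not escape either; iterating the choice
  yields an infinite path.\<close>

lemma BQ_escapes:
  assumes "BQ_state s"
  shows "escapes M s"
proof (rule ccontr)
  assume s: "\<not> escapes M s"
  define c where "c t = (\<not> escapes M (step True t))" for t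
  define S where "S n = ((\<lambda>t. step (c t) t) ^^ n) s" for n
  have "\<not> escapes M (S n)" for n
  proof (induction n)
    case (Suc n)
    have "S (Suc n) = step (c (S n)) (S n)" by (simp add: S_def)
    then show ?case
      using Suc escapes_if_both[of M "S n"] by (cases "c (S n)") (auto simp: c_def)
  qed (simp add: S_def s)
  moreover have "S (Suc n) = step (c (S n)) (S n)" for n by (simp add: S_def)
  moreover have "S 0 = s" by (simp add: S_def)
  ultimately interpret nonescaping_path M "\<lambda>n. c (S n)" "\<lambda>n. fst (S n)" "\<lambda>n. fst (snd (S n))" "\<lambda>n. snd (snd (S n))"
    using assms by unfold_locales (simp_all del: step.simps)
  show False by (rule impossible)
qed

text \<open>Compactness turns the local bounds on the length of words into a global one.\<close>

proposition finite_bounded_words: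
  assumes "compact C" "\<And>s. s \<in> C \<Longrightarrow> BQ_state s"
  shows "finite {w. \<exists>s\<in>C. bounded_by M (run w s)}"
proof -
  have "\<forall>s\<in>C. \<exists>U N. open U \<and> s \<in> U \<and> (\<forall>t\<in>U. \<forall>w. N \<le> length w \<longrightarrow> \<not> bounded_by M (run w t))"
    using BQ_escapes[OF assms(2), unfolded escapes_def] by (intro ballI)
  then have "\<exists>U N. \<forall>s\<in>C. open (U s) \<and> s \<in> U s \<and>
      (\<forall>t\<in>U s. \<forall>w. N s \<le> length w \<longrightarrow> \<not> bounded_by M (run w t))"
    by (simp only: bchoice_iff)
  then obtain U N where U: "\<forall>s\<in>C. open (U s) \<and> s \<in> U s \<and>
      (\<forall>t\<in>U s. \<forall>w. N s \<le> length w \<longrightarrow> \<not> bounded_by M (run w t))"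
    by (elim exE) (rule that)
  obtain F where F: "F \<subseteq> C" "finite F" "C \<subseteq> \<Union>(U ` F)"
    using compactE_image[OF assms(1), of C U] U by blast
  have "{w. \<exists>s\<in>C. bounded_by M (run w s)} \<subseteq> (\<Union>s\<in>F. {w. set w \<subseteq> UNIV \<and> length w \<le> N s})"
  proof
    fix w assume "w \<in> {w. \<exists>s\<in>C. bounded_by M (run w s)}"
    then obtain t s where ts: "t \<in> U s" "s \<in> F" "s \<in> C" "bounded_by M (run w t)"
      using F by blast
    then have "\<not> N s \<le> length w" using U by blast
    then show "w \<in> (\<Union>s\<in>F. {w. set w \<subseteq> UNIV \<and> length w \<le> N s})"
      using ts(2) by (auto intro!: bexI[of _ s])
  qed
  moreover have "finite (\<Union>s\<in>F. {w::bool list. set w \<subseteq> UNIV \<and> length w \<le> N s})"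
    using F(2) by (intro finite_UN_I finite_lists_length_le) auto
  ultimately show ?thesis by (rule finite_subset)
qed

section \<open>Normal forms and lengths in the free group\<close>

fun letter_inv :: "gen \<times> bool \<Rightarrow> gen \<times> bool" where
  "letter_inv (x, s) = (x, \<not> s)"

lemma letter_inv_letter_inv [simp]: "letter_inv (letter_inv l) = l" by (cases l) auto
lemma letter_inv_neq [simp]: "letter_inv l \<noteq> l" "l \<noteq> letter_inv l" by (cases l; auto)+
lemma letter_inv_inject [simp]: "letter_inv l = letter_inv m \<longleftrightarrow> l = m" by (metis letter_inv_letter_inv)

definition word_inv :: "word \<Rightarrow> word" where "word_inv w = map letter_inv (rev w)"

lemma word_inv_simps [simp]: "word_inv [] = []" "word_inv (v @ w) = word_inv w @ word_inv v"
  "word_inv (l # w) = word_inv w @ [letter_inv l]" "word_inv (word_inv w) = w" "length (word_inv w) = length w"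
  "word_inv w = [] \<longleftrightarrow> w = []"
  by (auto simp: word_inv_def rev_map comp_def)

text \<open>\<open>push\<close> multiplies a reduced word by a letter from the left; folding it over a word computes the
  reduced word of the same class.\<close>

fun push :: "gen \<times> bool \<Rightarrow> word \<Rightarrow> word" where
  "push l [] = [l]"
| "push l (m # w) = (if m = letter_inv l then w else l # m # w)"

definition reduce :: "word \<Rightarrow> word" where "reduce w = foldr push w []"

abbreviation reduced :: "word \<Rightarrow> bool" where
  "reduced \<equiv> successively (\<lambda>l m. m \<noteq> letter_inv l)"

lemma reduced_push: "reduced w \<Longrightarrow> reduced (push l w)"
  by (cases w) (auto simp: successively_Cons)

lemma push_letter_inv: "reduced w \<Longrightarrow> push l (push (letter_inv l) w) = w"
  by (cases w rule: remdups_adj.cases) auto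

lemma reduced_foldr: "reduced w \<Longrightarrow> reduced (foldr push v w)"
  by (induction v) (auto intro: reduced_push)

lemma reduced_reduce: "reduced (reduce w)"
  by (simp add: reduce_def reduced_foldr)

text \<open>Pushing a letter after its inverse does nothing to a reduced word, so cancelling pairs are
  invisible to \<open>reduce\<close>.\<close>

lemma reduce_cancel: "cancel v w \<Longrightarrow> reduce v = reduce w"
proof -
  assume "cancel v w"
  then obtain p q x s where "v = p @ [(x, s), (x, \<not> s)] @ q" "w = p @ q"
    unfolding cancel_def by blast
  then show ?thesis
    using push_letter_inv[OF reduced_reduce[of q], of "(x, s)"] by (simp add: reduce_def)
qed

lemma reduce_equiv: "equivclp cancel v w \<Longrightarrow> reduce v = reduce w"
  by (induction rule: equivclp_induct) (use reduce_cancel in auto)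

lemma reduce_id: "reduced w \<Longrightarrow> reduce w = w"
proof (induction w)
  case (Cons l w)
  have "reduced w" using Cons.prems by (cases w) auto
  then have "reduce (l # w) = push l w"
    using Cons.IH by (simp add: reduce_def)
  then show ?case using Cons.prems by (cases w) auto
qed (simp add: reduce_def)

lemma push_equiv: "equivclp cancel (l # w) (push l w)"
proof (cases w)
  case (Cons m v)
  show ?thesis
  proof (cases "m = letter_inv l")
    case True
    have "cancel (l # w) v"
      unfolding cancel_def Cons True
      by (intro exI[of _ "[]"] exI[of _ v] exI[of _ "fst l"] exI[of _ "snd l"]) (cases l, auto)
    then show ?thesis using True Cons by (simp add: r_into_equivclp)
  qed (use Cons in auto)
qed auto

lemma reduce_equivclp: "equivclp cancel w (reduce w)"
proof (induction w)
  case (Cons l w)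
  have "equivclp cancel ([l] @ w) ([l] @ reduce w)"
    by (rule equivclp_cancel_append_left[OF Cons])
  then show ?case
    using push_equiv[of l "reduce w"] equivclp_trans by (fastforce simp: reduce_def)
qed (simp add: reduce_def)

text \<open>A word is equivalent to its reduction, and equivalent words have the same one; so the reduced words
  are representatives of the classes.\<close>

lift_definition nf :: "free2 \<Rightarrow> word" is reduce
  by (rule reduce_equiv)

lift_definition of_word :: "word \<Rightarrow> free2" is "\<lambda>w. w" .

abbreviation mul (infixl "\<cdot>" 70) where "g \<cdot> h \<equiv> g \<otimes>\<^bsub>\<Gamma>\<^esub> h"
abbreviation ginv where "ginv g \<equiv> inv\<^bsub>\<Gamma>\<^esub> g"
abbreviation gone ("\<e>") where "\<e> \<equiv> \<one>\<^bsub>\<Gamma>\<^esub>"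

interpretation G: group \<Gamma> by (rule group_\<Gamma>)

lemma carrier_\<Gamma> [simp]: "carrier \<Gamma> = UNIV" by (simp add: \<Gamma>_def)

text \<open>As rewrite rules these equations decide the word problem in a group.\<close>

lemma group_simps:
  "g \<cdot> h \<cdot> k = g \<cdot> (h \<cdot> k)" "ginv g \<cdot> (g \<cdot> h) = h" "g \<cdot> (ginv g \<cdot> h) = h"
  "g \<cdot> ginv g = \<e>" "ginv g \<cdot> g = \<e>" "\<e> \<cdot> g = g" "g \<cdot> \<e> = g"
  "ginv (ginv g) = g" "ginv (g \<cdot> h) = ginv h \<cdot> ginv g" "ginv \<e> = \<e>"
proof -
  show "ginv g \<cdot> (g \<cdot> h) = h" "g \<cdot> (ginv g \<cdot> h) = h"
    by (simp_all flip: G.m_assoc)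
qed (simp_all add: G.m_assoc G.inv_mult_group)

lemma of_word_append: "of_word (v @ w) = of_word v \<cdot> of_word w"
  unfolding \<Gamma>_def monoid.simps by transfer simp

lemma of_word_Nil: "of_word [] = \<e>"
  unfolding \<Gamma>_def monoid.simps by transfer simp

lemma of_word_nf [simp]: "of_word (nf g) = g"
  by transfer (simp add: equivclp_sym reduce_equivclp)

lemma nf_of_word: "nf (of_word w) = reduce w"
  by transfer simp

lemma reduced_nf: "reduced (nf g)"
  by transfer (rule reduced_reduce)

lemma nf_eqI: "reduced w \<Longrightarrow> g = of_word w \<Longrightarrow> nf g = w"
  by (simp add: nf_of_word reduce_id)

lemma nf_inject: "nf g = nf h \<longleftrightarrow> g = h"
  by (metis of_word_nf)

lemma of_word_word_inv: "of_word (word_inv w) = ginv (of_word w)"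
proof -
  have "word_inv w = map (\<lambda>(x, s). (x, \<not> s)) (rev w)"
    unfolding word_inv_def by (rule map_cong) auto
  then have "equivclp cancel (word_inv w @ w) []"
    using equivclp_cancel_inverse_word[of w] by simp
  then have "of_word (word_inv w @ w) = of_word []"
    by transfer
  then have "of_word (word_inv w @ w) = \<e>"
    by (simp add: of_word_Nil)
  then show ?thesis
    by (intro G.inv_equality[symmetric]) (auto simp: of_word_append)
qed

lemma reduced_word_inv: "reduced w \<Longrightarrow> reduced (word_inv w)"
  by (auto simp: word_inv_def successively_map successively_rev elim!: successively_mono)

lemma nf_ginv: "nf (ginv g) = word_inv (nf g)"
  by (rule nf_eqI) (auto simp: reduced_word_inv reduced_nf of_word_word_inv)

text \<open>The longest common prefix enters through its length only.\<close>

fun lcp :: "'a list \<Rightarrow> 'a list \<Rightarrow> nat" where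
  "lcp (x # xs) (y # ys) = (if x = y then Suc (lcp xs ys) else 0)"
| "lcp _ _ = 0"

lemma lcp_commute: "lcp v w = lcp w v"
  by (induction v w rule: lcp.induct) auto

lemma lcp_le: "lcp v w \<le> length v"
  by (induction v w rule: lcp.induct) auto

lemma lcp_ultra: "min (lcp u v) (lcp v w) \<le> lcp u w"
proof (induction u w arbitrary: v rule: lcp.induct)
  case (1 x xs y ys)
  show ?case
  proof (cases v)
    case (Cons a l)
    then show ?thesis using 1[of l] by auto
  qed simp
qed auto

lemma lcp_same [simp]: "lcp w w = length w"
  by (induction w) auto

lemma lcp_take: "lcp (take n w) w = min n (length w)"
  by (induction w arbitrary: n) (auto simp: take_Cons split: nat.splits)

lemma lcp_nth: "i < lcp v w \<Longrightarrow> v ! i = w ! i"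
  by (induction v w arbitrary: i rule: lcp.induct) (auto simp: nth_Cons split: if_splits nat.splits)

lemma lcp_split:
  obtains p v' w' where "v = p @ v'" "w = p @ w'" "length p = lcp v w"
    "v' = [] \<or> w' = [] \<or> hd v' \<noteq> hd w'"
proof -
  have "\<exists>p v' w'. v = p @ v' \<and> w = p @ w' \<and> length p = lcp v w \<and> (v' = [] \<or> w' = [] \<or> hd v' \<noteq> hd w')"
  proof (induction v w rule: lcp.induct)
    case (1 x xs y ys)
    show ?case
    proof (cases "x = y")
      case True
      then obtain p v' w' where "xs = p @ v'" "ys = p @ w'" "length p = lcp xs ys"
        "v' = [] \<or> w' = [] \<or> hd v' \<noteq> hd w'" using 1 by blast
      then show ?thesis using True by (intro exI[of _ "x # p"] exI[of _ v'] exI[of _ w']) auto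
    next
      case False
      then show ?thesis
        by (intro exI[of _ "[]"] exI[of _ "x # xs"] exI[of _ "y # ys"]) simp
    qed
  qed auto
  then show ?thesis using that by blast
qed

definition len :: "free2 \<Rightarrow> nat" where "len g = length (nf g)"

text \<open>The Gromov product with respect to \<open>\<one>\<close> in the Cayley tree: the length of the common initial segment of
  the geodesics from \<open>\<one>\<close> to \<open>g\<close> and to \<open>h\<close>. The properties below (\<open>gromov_ultra\<close>, \<open>len_mul\<close>,
  \<open>prefix_exists\<close>, \<open>gromov_inverse_small\<close>) are all that the shortening steps of
  Nielsen reduction need to know about words.\<close>

definition gromov :: "free2 \<Rightarrow> free2 \<Rightarrow> nat" where "gromov g h = lcp (nf g) (nf h)"

lemma len_ginv [simp]: "len (ginv g) = len g"
  by (simp add: len_def nf_ginv)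

lemma nf_one: "nf \<e> = []"
  by (rule nf_eqI) (auto simp: of_word_Nil)

lemma len_one [simp]: "len \<e> = 0"
  by (simp add: len_def nf_one)

lemma len_eq_0 [simp]: "len g = 0 \<longleftrightarrow> g = \<e>"
  using nf_inject[of g "\<e>"] by (simp add: len_def nf_one)

lemma gromov_commute: "gromov g h = gromov h g" and gromov_le: "gromov g h \<le> len g"
  and gromov_self [simp]: "gromov g g = len g"
  and gromov_ultra: "min (gromov g h) (gromov h k) \<le> gromov g k"
proof -
  show "gromov g h = gromov h g" by (simp add: gromov_def lcp_commute)
  show "gromov g h \<le> len g" by (simp add: gromov_def len_def lcp_le)
  show "gromov g g = len g" by (simp add: gromov_def len_def)
  show "min (gromov g h) (gromov h k) \<le> gromov g k" by (simp only: gromov_def lcp_ultra)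
qed

text \<open>In the product of the inverse of \<open>g\<close> with \<open>h\<close> exactly the common prefix cancels.\<close>

lemma len_mul: "len (ginv g \<cdot> h) + 2 * gromov g h = len g + len h"
proof -
  obtain p v w where s: "nf g = p @ v" "nf h = p @ w" "length p = gromov g h"
    "v = [] \<or> w = [] \<or> hd v \<noteq> hd w"
    unfolding gromov_def by (rule lcp_split)
  have "g = of_word p \<cdot> of_word v" "h = of_word p \<cdot> of_word w"
    using of_word_nf[of g] of_word_nf[of h] by (simp_all add: s of_word_append)
  then have "ginv g \<cdot> h = of_word (word_inv v @ w)"
    by (simp add: of_word_append of_word_word_inv group_simps)
  moreover have "reduced (word_inv v @ w)"
  proof -
    have "reduced v" "reduced w"
      using reduced_nf[of g] reduced_nf[of h] by (auto simp: s successively_append_iff)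
    moreover have "last (word_inv v) = letter_inv (hd v)" if "v \<noteq> []"
      using that by (cases v) auto
    ultimately show ?thesis
      using s(4) by (auto simp: successively_append_iff reduced_word_inv)
  qed
  ultimately have "nf (ginv g \<cdot> h) = word_inv v @ w" by (rule nf_eqI[rotated])
  then show ?thesis using s by (simp add: len_def)
qed

lemma prefix_exists:
  assumes "n \<le> len g"
  obtains p where "len p = n" "gromov p g = n"
proof -
  have "reduced (take n (nf g))"
    using reduced_nf[of g] successively_append_iff[of _ "take n (nf g)" "drop n (nf g)"] by simp
  then have "nf (of_word (take n (nf g))) = take n (nf g)"
    by (rule nf_eqI[OF _ refl])
  then show ?thesis
    using that[of "of_word (take n (nf g))"] assms by (simp add: len_def gromov_def lcp_take)
qed

text \<open>Otherwise at least the first half of the word \<open>g\<close> agrees with that of its inverse; then the middle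
  letter is its own inverse, or the two middle letters cancel.\<close>

lemma gromov_inverse_small:
  assumes "g \<noteq> \<e>"
  shows "2 * gromov g (ginv g) < len g"
proof (rule ccontr)
  let ?w = "nf g"
  assume "\<not> ?thesis"
  then have big: "len g \<le> 2 * gromov g (ginv g)" by simp
  have pos: "0 < length ?w"
    using assms len_eq_0[of g] by (simp add: len_def del: len_eq_0)
  have nth: "?w ! i = letter_inv (?w ! (length ?w - 1 - i))" if "i < gromov g (ginv g)" for i
  proof -
    have "i < length ?w" using that gromov_le[of g "ginv g"] by (simp add: len_def)
    then have "word_inv ?w ! i = letter_inv (?w ! (length ?w - 1 - i))"
      by (simp add: word_inv_def rev_nth)
    then show ?thesis using lcp_nth[of i ?w "word_inv ?w"] that by (simp add: gromov_def nf_ginv)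
  qed
  show False
  proof (cases "even (length ?w)")
    case True
    then obtain m where m: "length ?w = 2 * m" by (rule evenE)
    then obtain k where k: "m = Suc k" using pos by (cases m) auto
    have "?w ! k = letter_inv (?w ! Suc k)"
      using nth[of k] big m k by (simp add: len_def)
    moreover have "?w ! Suc k \<noteq> letter_inv (?w ! k)"
      using reduced_nf[of g] m k by (simp add: successively_conv_nth)
    ultimately show False by simp
  next
    case False
    then obtain m where m: "length ?w = 2 * m + 1" by (rule oddE)
    have "?w ! m = letter_inv (?w ! m)"
      using nth[of m] big m by (simp add: len_def)
    then show False by simp
  qed
qed

section \<open>Free bases\<close>

fun lval :: "free2 \<Rightarrow> free2 \<Rightarrow> gen \<times> bool \<Rightarrow> free2" where
  "lval u v (GenA, s) = (if s then u else ginv u)"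
| "lval u v (GenB, s) = (if s then v else ginv v)"

definition wval :: "free2 \<Rightarrow> free2 \<Rightarrow> word \<Rightarrow> free2" where
  "wval u v w = foldr (\<lambda>l g. lval u v l \<cdot> g) w \<e>"

lemma lval_letter_inv [simp]: "lval u v (letter_inv l) = ginv (lval u v l)"
  by (cases "(u, v, l)" rule: lval.cases) (auto simp: group_simps)

lemma wval_simps [simp]:
  "wval u v [] = \<e>" "wval u v (l # w) = lval u v l \<cdot> wval u v w"
  "wval u v (w @ w') = wval u v w \<cdot> wval u v w'"
proof -
  show "wval u v (w @ w') = wval u v w \<cdot> wval u v w'"
    by (induction w) (auto simp: wval_def group_simps)
qed (simp_all add: wval_def)

lemma wval_push: "wval u v (push l w) = lval u v l \<cdot> wval u v w"
  by (cases w) (auto simp: group_simps)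

lemma wval_reduce: "wval u v (reduce w) = wval u v w"
  unfolding reduce_def by (induction w) (auto simp: wval_push)

text \<open>The endomorphism of \<open>\<Gamma>\<close> with \<open>a \<mapsto> u\<close> and \<open>b \<mapsto> v\<close>.\<close>

definition ev :: "free2 \<Rightarrow> free2 \<Rightarrow> free2 \<Rightarrow> free2" where
  "ev u v g = wval u v (nf g)"

lemma ev_of_word: "ev u v (of_word w) = wval u v w"
  by (simp add: ev_def nf_of_word wval_reduce)

lemma ev_mul: "ev u v (g \<cdot> h) = ev u v g \<cdot> ev u v h"
proof -
  have "g \<cdot> h = of_word (nf g @ nf h)" by (simp add: of_word_append)
  then show ?thesis by (simp only: ev_of_word wval_simps) (simp add: ev_def)
qed

lemma ev_hom: "ev u v \<in> hom \<Gamma> \<Gamma>"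
  by (auto simp: hom_def ev_mul)

lemma hom_simps:
  assumes "\<phi> \<in> hom \<Gamma> \<Gamma>"
  shows "\<phi> (g \<cdot> h) = \<phi> g \<cdot> \<phi> h" "\<phi> (ginv g) = ginv (\<phi> g)" "\<phi> \<e> = \<e>"
proof -
  interpret group_hom \<Gamma> \<Gamma> \<phi> using assms by unfold_locales
  show "\<phi> (g \<cdot> h) = \<phi> g \<cdot> \<phi> h" "\<phi> (ginv g) = ginv (\<phi> g)" "\<phi> \<e> = \<e>" by simp_all
qed

lemma gen_words: "gen_a = of_word [(GenA, True)]" "gen_b = of_word [(GenB, True)]"
  unfolding gen_a_def gen_b_def by (transfer, simp)+

lemma ev_simps [simp]: "ev u v gen_a = u" "ev u v gen_b = v"
  "ev u v (ginv g) = ginv (ev u v g)" "ev u v \<e> = \<e>"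
  using hom_simps[OF ev_hom] by (simp_all add: gen_words ev_of_word group_simps)

lemma lval_gen: "lval gen_a gen_b l = of_word [l]"
proof -
  have "ginv (of_word [(x, True)]) = of_word [(x, False)]" for x
    using of_word_word_inv[of "[(x, True)]"] by simp
  then show ?thesis
    by (cases "(gen_a, gen_b, l)" rule: lval.cases) (auto simp: gen_words)
qed

lemma of_word_Cons: "of_word (l # w) = lval gen_a gen_b l \<cdot> of_word w"
  using of_word_append[of "[l]" w] by (simp add: lval_gen)

lemma hom_eq_ev:
  assumes "\<phi> \<in> hom \<Gamma> \<Gamma>"
  shows "\<phi> = ev (\<phi> gen_a) (\<phi> gen_b)"
proof
  fix g
  have "\<phi> (lval gen_a gen_b l) = lval (\<phi> gen_a) (\<phi> gen_b) l" for l
    by (cases "(gen_a, gen_b, l)" rule: lval.cases) (auto simp: hom_simps[OF assms])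
  then have "\<phi> (of_word w) = wval (\<phi> gen_a) (\<phi> gen_b) w" for w
    by (induction w) (auto simp: of_word_Nil of_word_Cons hom_simps[OF assms])
  from this[of "nf g"] show "\<phi> g = ev (\<phi> gen_a) (\<phi> gen_b) g"
    by (simp add: ev_def)
qed

lemma ev_comp: "ev u v (ev p q g) = ev (ev u v p) (ev u v q) g"
proof -
  have "ev u v \<circ> ev p q \<in> hom \<Gamma> \<Gamma>"
    by (auto simp: hom_def ev_mul)
  from hom_eq_ev[OF this] show ?thesis by (metis comp_apply ev_simps(1,2))
qed

lemma ev_gen [simp]: "ev gen_a gen_b g = g"
proof -
  have "id \<in> hom \<Gamma> \<Gamma>" by (auto simp: hom_def)
  from hom_eq_ev[OF this] show ?thesis by (metis id_apply)
qed

lemma free_basis_iff: "free_basis u v \<longleftrightarrow> bij (ev u v)"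
proof
  assume "free_basis u v"
  then obtain \<phi> where "\<phi> \<in> iso \<Gamma> \<Gamma>" "\<phi> gen_a = u" "\<phi> gen_b = v"
    unfolding free_basis_def by blast
  then show "bij (ev u v)"
    using hom_eq_ev[of \<phi>] by (auto simp: iso_def)
next
  assume "bij (ev u v)"
  then have "ev u v \<in> iso \<Gamma> \<Gamma>" by (simp add: iso_def ev_hom)
  then show "free_basis u v"
    unfolding free_basis_def by (rule bexI[rotated]) simp
qed

section \<open>Elementary moves on free bases\<close>

type_synonym gpair = "free2 \<times> free2"

fun pair_step :: "bool \<Rightarrow> gpair \<Rightarrow> gpair" where
  "pair_step True (u, v) = (u, u \<cdot> v)"
| "pair_step False (u, v) = (u \<cdot> v, v)"

definition pair_run :: "bool list \<Rightarrow> gpair \<Rightarrow> gpair" where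
  "pair_run w p = fold pair_step w p"

lemma pair_run_simps [simp]:
  "pair_run [] p = p" "pair_run (l # w) p = pair_run w (pair_step l p)" "pair_run (v @ w) p = pair_run w (pair_run v p)"
  by (simp_all add: pair_run_def)

text \<open>Exponents \<open>1\<close> and \<open>-1\<close>.\<close>

fun signed :: "bool \<Rightarrow> free2 \<Rightarrow> free2" where
  "signed True g = g"
| "signed False g = ginv g"

text \<open>The eight signed permutations of a pair: the signs \<open>e\<close> and \<open>f\<close> belong to \<open>u\<close> and \<open>v\<close>, and are
  applied before the swap \<open>s\<close>.\<close>

fun dihedral :: "bool \<times> bool \<times> bool \<Rightarrow> gpair \<Rightarrow> gpair" where
  "dihedral (s, e, f) (u, v) = (if s then (signed f v, signed e u) else (signed e u, signed f v))"

fun conj_pair :: "free2 \<Rightarrow> gpair \<Rightarrow> gpair" where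
  "conj_pair g (u, v) = (g \<cdot> u \<cdot> ginv g, g \<cdot> v \<cdot> ginv g)"

fun basis :: "gpair \<Rightarrow> bool" where "basis (u, v) = free_basis u v"

text \<open>If \<open>(p, q)\<close> is a basis, with the inverse automorphism given by \<open>(p', q')\<close>, then substituting \<open>u, v\<close>
  for \<open>a, b\<close> in \<open>p, q\<close> is composition with an automorphism.\<close>

lemma basis_change:
  assumes "basis (u, v)"
    and "ev p q p' = gen_a" "ev p q q' = gen_b" "ev p' q' p = gen_a" "ev p' q' q = gen_b"
  shows "basis (ev u v p, ev u v q)"
proof -
  have "bij (ev p q)"
    by (rule o_bij[of "ev p' q'"]) (auto simp: fun_eq_iff ev_comp assms(2-5))
  then have "bij (ev u v \<circ> ev p q)"
    using assms(1) bij_comp by (auto simp: free_basis_iff)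
  moreover have "ev u v \<circ> ev p q = ev (ev u v p) (ev u v q)"
    by (simp add: fun_eq_iff ev_comp)
  ultimately show ?thesis by (simp add: free_basis_iff)
qed

lemma basis_pair_step: "basis p \<Longrightarrow> basis (pair_step b p)"
  using basis_change[of "fst p" "snd p" gen_a "gen_a \<cdot> gen_b" gen_a "ginv gen_a \<cdot> gen_b"]
    basis_change[of "fst p" "snd p" "gen_a \<cdot> gen_b" gen_b "gen_a \<cdot> ginv gen_b" gen_b]
  by (cases p; cases b) (auto simp: ev_mul group_simps)

lemma basis_pair_run: "basis p \<Longrightarrow> basis (pair_run w p)"
proof (induction w arbitrary: p)
  case (Cons l w)
  show ?case using Cons.IH[OF basis_pair_step[OF Cons.prems]] by simp
qed simp

lemma basis_unstep: "basis (u, v) \<Longrightarrow> basis (u, ginv u \<cdot> v)"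
  using basis_change[of u v gen_a "ginv gen_a \<cdot> gen_b" gen_a "gen_a \<cdot> gen_b"]
  by (auto simp: ev_mul group_simps)

lemma basis_dihedral:
  assumes "basis p"
  shows "basis (dihedral d p)"
proof -
  obtain u v s e f where [simp]: "p = (u, v)" "d = (s, e, f)" by (cases p, cases d)
  show ?thesis
    using assms basis_change[of u v "signed e gen_a" "signed f gen_b" "signed e gen_a" "signed f gen_b"]
      basis_change[of u v "signed f gen_b" "signed e gen_a" "signed e gen_b" "signed f gen_a"]
    by (cases s; cases e; cases f) (auto simp: group_simps)
qed

lemma ev_conj_pair: "ev (g \<cdot> u \<cdot> ginv g) (g \<cdot> v \<cdot> ginv g) x = g \<cdot> ev u v x \<cdot> ginv g"
proof -
  have "(\<lambda>x. g \<cdot> ev u v x \<cdot> ginv g) \<in> hom \<Gamma> \<Gamma>"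
    by (auto simp: hom_def ev_mul group_simps)
  from hom_eq_ev[OF this] show ?thesis by (metis ev_simps(1,2))
qed

lemma basis_conj_pair:
  assumes "basis p"
  shows "basis (conj_pair g p)"
proof -
  obtain u v where [simp]: "p = (u, v)" by (cases p)
  have "bij (\<lambda>x. g \<cdot> x \<cdot> ginv g)"
    by (rule o_bij[of "\<lambda>x. ginv g \<cdot> x \<cdot> g"]) (auto simp: fun_eq_iff group_simps)
  then have "bij ((\<lambda>x. g \<cdot> x \<cdot> ginv g) \<circ> ev u v)"
    using assms bij_comp by (auto simp: free_basis_iff)
  moreover have "(\<lambda>x. g \<cdot> x \<cdot> ginv g) \<circ> ev u v = ev (g \<cdot> u \<cdot> ginv g) (g \<cdot> v \<cdot> ginv g)"
    by (simp add: fun_eq_iff ev_conj_pair)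
  ultimately show ?thesis by (simp add: free_basis_iff)
qed

lemma basis_gen: "basis (gen_a, gen_b)"
proof -
  have "ev gen_a gen_b = id" by (simp add: fun_eq_iff)
  then show ?thesis by (simp add: free_basis_iff)
qed

text \<open>The normal form for free bases, a counterpart of writing a matrix in \<open>GL(2, \<int>)\<close> as a non-negative
  matrix of determinant \<open>1\<close> between two signed permutation matrices.\<close>

definition standard :: "gpair \<Rightarrow> bool" where
  "standard p \<longleftrightarrow> (\<exists>g d w d'. p = conj_pair g (dihedral d' (pair_run w (dihedral d (gen_a, gen_b)))))"

lemma conj_pair_conj_pair: "conj_pair g (conj_pair h p) = conj_pair (g \<cdot> h) p"
  by (cases p) (simp add: group_simps)

lemma conj_pair_one [simp]: "conj_pair \<e> p = p"
  by (cases p) (simp add: group_simps)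

lemma dihedral_conj_pair: "dihedral d (conj_pair g p) = conj_pair g (dihedral d p)"
proof -
  obtain u v s e f where [simp]: "p = (u, v)" "d = (s, e, f)" by (cases p, cases d)
  show ?thesis by (cases s; cases e; cases f) (auto simp: group_simps)
qed

lemma dihedral_dihedral: "\<exists>d''. \<forall>p. dihedral d (dihedral d' p) = dihedral d'' p"
proof -
  obtain s e f s' e' f' where [simp]: "d = (s, e, f)" "d' = (s', e', f')" by (cases d, cases d')
  have "signed a (signed b x) = signed (a = b) x" for a b x
    by (cases a; cases b) (auto simp: group_simps)
  then have "dihedral d (dihedral d' p) = dihedral (s \<noteq> s', (if s' then f else e) = e', (if s' then e else f) = f') p" for p
    by (cases p) auto
  then show ?thesis by blast
qed

lemma standard_conj_pair: "standard p \<Longrightarrow> standard (conj_pair g p)"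
  unfolding standard_def using conj_pair_conj_pair by blast

lemma standard_dihedral: "standard p \<Longrightarrow> standard (dihedral d p)"
  unfolding standard_def using dihedral_conj_pair dihedral_dihedral by metis

lemma standard_conj_pair_iff: "standard (conj_pair g p) \<longleftrightarrow> standard p"
  using standard_conj_pair[of "conj_pair g p" "ginv g"] standard_conj_pair[of p g] by (auto simp: conj_pair_conj_pair group_simps)

lemma dihedral_undo: "\<exists>d'. dihedral d' (dihedral d p) = p"
proof -
  obtain u v s e f where [simp]: "p = (u, v)" "d = (s, e, f)" by (cases p, cases d)
  have "dihedral (s, if s then f else e, if s then e else f) (dihedral d p) = p"
    by (cases s; cases e; cases f) (auto simp: group_simps)
  then show ?thesis by blast
qed

lemma standard_dihedral_iff: "standard (dihedral d p) \<longleftrightarrow> standard p"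
  using dihedral_undo standard_dihedral by metis

lemma standard_word: "standard (pair_run w (dihedral d (gen_a, gen_b)))"
proof -
  have "pair_run w (dihedral d (gen_a, gen_b)) = conj_pair \<e> (dihedral (False, True, True) (pair_run w (dihedral d (gen_a, gen_b))))"
    by (cases "pair_run w (dihedral d (gen_a, gen_b))") simp
  then show ?thesis unfolding standard_def by metis
qed

text \<open>An inverse move either cancels the last letter of the word, or meets the other letter. In that
  case, up to conjugation, it can be replaced by a positive move followed by a signed permutation:
  for matrices this is the relation \<open>R L\<^sup>-\<^sup>1 = L S\<close>, where \<open>S\<close> is the rotation by a right angle.\<close>

lemma standard_undo:
  assumes "pair_run w (dihedral d (gen_a, gen_b)) = (u, v)"
  shows "standard (u, ginv u \<cdot> v)" "standard (u \<cdot> ginv v, v)"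
proof -
  let ?p = "dihedral d (gen_a, gen_b)"
  consider "w = []" | w' b where "w = w' @ [b]" by (cases w rule: rev_cases) auto
  then have "standard (u, ginv u \<cdot> v) \<and> standard (u \<cdot> ginv v, v)"
  proof cases
    case 1
    obtain d1 where d1: "dihedral (False, False, True) ?p = dihedral d1 (gen_a, gen_b)" using dihedral_dihedral by blast
    obtain d2 where d2: "dihedral (False, True, False) ?p = dihedral d2 (gen_a, gen_b)" using dihedral_dihedral by blast
    have p: "?p = (u, v)" using assms 1 by simp
    have "(u, ginv u \<cdot> v) = dihedral (False, False, True) (pair_run [True] (dihedral d1 (gen_a, gen_b)))"
      unfolding d1[symmetric] p by (simp add: group_simps)
    moreover have "(u \<cdot> ginv v, v) = dihedral (False, True, False) (pair_run [False] (dihedral d2 (gen_a, gen_b)))"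
      unfolding d2[symmetric] p by (simp add: group_simps)
    ultimately show ?thesis
      using standard_dihedral[OF standard_word] by metis
  next
    case (2 w' b)
    obtain x y where xy: "pair_run w' ?p = (x, y)" by (cases "pair_run w' ?p")
    have std: "standard (x, y)" using standard_word[of w' d] xy by simp
    have step: "standard (pair_step c (x, y))" for c
      using standard_word[of "w' @ [c]" d] xy by simp
    have uv: "(u, v) = pair_step b (x, y)" using assms 2 xy by simp
    show ?thesis
    proof (cases b)
      case True
      have eq: "(u \<cdot> ginv v, v) = conj_pair (x \<cdot> y) (dihedral (True, True, False) (pair_step False (x, y)))"
        using uv True by (simp add: group_simps)
      have "standard (u \<cdot> ginv v, v)"
        unfolding eq by (intro standard_conj_pair standard_dihedral step)
      then show ?thesis
        using uv True std by (simp add: group_simps)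
    next
      case False
      have eq: "(u, ginv u \<cdot> v) = conj_pair (ginv (x \<cdot> y)) (dihedral (True, False, True) (pair_step True (x, y)))"
        using uv False by (simp add: group_simps)
      have "standard (u, ginv u \<cdot> v)"
        unfolding eq by (intro standard_conj_pair standard_dihedral step)
      then show ?thesis
        using uv False std by (simp add: group_simps)
    qed
  qed
  then show "standard (u, ginv u \<cdot> v)" "standard (u \<cdot> ginv v, v)" by auto
qed

lemma pair_step_conj_pair: "pair_step b (conj_pair g p) = conj_pair g (pair_step b p)"
  by (cases p; cases b) (auto simp: group_simps)

text \<open>Up to conjugation, a signed permutation turns the move \<open>(u, v) \<mapsto> (u, u v)\<close> into one of the two
  positive moves or their inverses; for the latter \<open>standard_undo\<close> applies.\<close>

lemma standard_step:
  assumes "standard p"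
  shows "standard (pair_step True p)"
proof -
  obtain g d w d' where p: "p = conj_pair g (dihedral d' (pair_run w (dihedral d (gen_a, gen_b))))"
    using assms unfolding standard_def by blast
  obtain u v where uv: "pair_run w (dihedral d (gen_a, gen_b)) = (u, v)" by (cases "pair_run w (dihedral d (gen_a, gen_b))")
  obtain s e f where d': "d' = (s, e, f)" by (cases d')
  have fwd: "standard (u, u \<cdot> v)" "standard (u \<cdot> v, v)"
    using standard_word[of "w @ [True]" d] standard_word[of "w @ [False]" d] uv by simp_all
  note bwd = standard_undo[OF uv]
  have "\<exists>h c q. pair_step True (dihedral d' (u, v)) = conj_pair h (dihedral c q) \<and> standard q"
  proof -
    consider "\<not> s" "e" "f" | "\<not> s" "e" "\<not> f" | "\<not> s" "\<not> e" "f" | "\<not> s" "\<not> e" "\<not> f"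
      | "s" "e" "f" | "s" "e" "\<not> f" | "s" "\<not> e" "f" | "s" "\<not> e" "\<not> f" by blast
    then show ?thesis
    proof cases
      case 1 then show ?thesis using fwd(1) d'
        by (intro exI[of _ \<e>] exI[of _ "(False, True, True)"] exI[of _ "(u, u \<cdot> v)"]) (simp add: group_simps)
    next
      case 2 then show ?thesis using bwd(1) d'
        by (intro exI[of _ u] exI[of _ "(False, True, False)"] exI[of _ "(u, ginv u \<cdot> v)"]) (simp add: group_simps)
    next
      case 3 then show ?thesis using bwd(1) d'
        by (intro exI[of _ \<e>] exI[of _ "(False, False, True)"] exI[of _ "(u, ginv u \<cdot> v)"]) (simp add: group_simps)
    next
      case 4 then show ?thesis using fwd(1) d'
        by (intro exI[of _ "ginv u"] exI[of _ "(False, False, False)"] exI[of _ "(u, u \<cdot> v)"]) (simp add: group_simps)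
    next
      case 5 then show ?thesis using fwd(2) d'
        by (intro exI[of _ v] exI[of _ "(True, True, True)"] exI[of _ "(u \<cdot> v, v)"]) (simp add: group_simps)
    next
      case 6 then show ?thesis using bwd(2) d'
        by (intro exI[of _ "ginv v"] exI[of _ "(True, True, False)"] exI[of _ "(u \<cdot> ginv v, v)"]) (simp add: group_simps)
    next
      case 7 then show ?thesis using bwd(2) d'
        by (intro exI[of _ \<e>] exI[of _ "(True, False, True)"] exI[of _ "(u \<cdot> ginv v, v)"]) (simp add: group_simps)
    next
      case 8 then show ?thesis using fwd(2) d'
        by (intro exI[of _ \<e>] exI[of _ "(True, False, False)"] exI[of _ "(u \<cdot> v, v)"]) (simp add: group_simps)
    qed
  qed
  then have "standard (pair_step True (dihedral d' (u, v)))"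
    using standard_conj_pair[OF standard_dihedral] by metis
  then show ?thesis
    by (simp add: p uv pair_step_conj_pair standard_conj_pair)
qed

section \<open>Nielsen reduction\<close>

text \<open>In a product of three letters that is reduced as a word in \<open>u\<close> and \<open>v\<close>, a part of the middle one
  survives the cancellation on both of its sides.\<close>

definition no_cancel :: "free2 \<Rightarrow> free2 \<Rightarrow> bool" where
  "no_cancel u v \<longleftrightarrow> (\<forall>i j k. i \<noteq> letter_inv j \<longrightarrow> k \<noteq> letter_inv j \<longrightarrow>
     gromov (ginv (lval u v i)) (lval u v j) + gromov (ginv (lval u v j)) (lval u v k) < len (lval u v j))"

lemma len_mul': "len (g \<cdot> h) + 2 * gromov (ginv g) h = len g + len h"
  using len_mul[of "ginv g" h] by (simp add: group_simps)

lemma gromov_mul: "gromov g (g \<cdot> h) + gromov (ginv g) h = len g"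
  using len_mul[of g "g \<cdot> h"] len_mul'[of g h] by (simp add: group_simps)

text \<open>Each letter keeps a part of its own, so the value is at least as long as the word. The
  first claim, that a letter \<open>i\<close> in front cancels against the whole word just as it does
  against its first letter, is what makes the induction work.\<close>

lemma len_wval:
  assumes "no_cancel u v" "reduced (j # w)" "i \<noteq> letter_inv j"
  shows "gromov (ginv (lval u v i)) (wval u v (j # w)) = gromov (ginv (lval u v i)) (lval u v j)
    \<and> length (j # w) + gromov (ginv (lval u v i)) (lval u v j) \<le> len (wval u v (j # w))"
  using assms(2,3)
proof (induction w arbitrary: i j)
  case Nil
  have "gromov (ginv (lval u v i)) (lval u v j) + gromov (ginv (lval u v j)) (lval u v j) < len (lval u v j)"
    using assms(1) Nil unfolding no_cancel_def by (metis letter_inv_neq(1))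
  then show ?case by (simp add: group_simps)
next
  case (Cons k w)
  let ?x = "ginv (lval u v i)" and ?y = "lval u v j" and ?g = "wval u v (k # w)"
  have k: "k \<noteq> letter_inv j" and red: "reduced (k # w)" using Cons.prems by auto
  then have "j \<noteq> letter_inv k" by auto
  note IH = Cons.IH[OF red this]
  have cancel: "gromov ?x ?y + gromov (ginv ?y) ?g < len ?y"
    using assms(1) Cons.prems(2) k IH unfolding no_cancel_def by metis
  then have lt: "gromov ?x ?y < gromov ?y (?y \<cdot> ?g)"
    using gromov_mul[of ?y ?g] by linarith
  (* of the three Gromov products between three points of a tree the two smallest agree *)
  have "gromov ?x (?y \<cdot> ?g) = gromov ?x ?y"
    using gromov_ultra[of ?x ?y "?y \<cdot> ?g"] lt
      gromov_ultra[of ?x "?y \<cdot> ?g" ?y, unfolded gromov_commute[of "?y \<cdot> ?g" ?y]]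
    by (auto simp: min_def split: if_splits)
  moreover have "length (j # k # w) + gromov ?x ?y \<le> len (?y \<cdot> ?g)"
    using len_mul'[of ?y ?g] IH cancel by simp
  ultimately show ?case by simp
qed

lemma len_gens: "len gen_a = 1" "len gen_b = 1" "gen_a \<noteq> gen_b" "gen_a \<noteq> ginv gen_b"
proof -
  have nf: "nf gen_a = [(GenA, True)]" "nf gen_b = [(GenB, True)]"
    by (simp_all add: gen_words nf_of_word reduce_id)
  show "len gen_a = 1" "len gen_b = 1" by (simp_all add: len_def nf)
  show "gen_a \<noteq> gen_b" "gen_a \<noteq> ginv gen_b"
    unfolding nf_inject[symmetric] nf_ginv nf by simp_all
qed

text \<open>Both \<open>a\<close> and \<open>b\<close> are values of words in \<open>u, v\<close>. They have length \<open>1\<close>, so these words are single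
  letters.\<close>

lemma standard_if_no_cancel:
  assumes "no_cancel u v" "basis (u, v)"
  shows "standard (u, v)"
proof -
  have letter: "\<exists>j. g = lval u v j" if len1: "len g = 1" for g
  proof -
    have "surj (ev u v)" using assms(2) by (simp add: free_basis_iff bij_is_surj)
    then obtain h where h: "g = ev u v h" by (rule surjE)
    then obtain j w where jw: "nf h = j # w"
      using len1 by (cases "nf h") (auto simp: ev_def)
    then have "length (j # w) \<le> len (wval u v (j # w))"
      using len_wval[OF assms(1), of j w j] reduced_nf[of h] by simp
    then have "w = []" using len1 h jw by (simp add: ev_def)
    then have "g = lval u v j" using h jw by (simp add: ev_def group_simps)
    then show ?thesis by blast
  qed
  obtain j where j: "gen_a = lval u v j" using letter[OF len_gens(1)] by blast
  obtain k where k: "gen_b = lval u v k" using letter[OF len_gens(2)] by blast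
  obtain x s where xs: "j = (x, s)" by (cases j)
  obtain y t where yt: "k = (y, t)" by (cases k)
  have "x \<noteq> y"
  proof
    assume "x = y"
    then have "lval u v k = lval u v j \<or> lval u v k = ginv (lval u v j)"
      by (cases y; cases s; cases t) (simp_all add: xs yt group_simps)
    then have "gen_b = gen_a \<or> gen_b = ginv gen_a" by (simp only: j k)
    then show False using len_gens(3,4) group_simps(8)[of gen_a] by metis
  qed
  have signed: "g = signed s h" if "h = (if s then g else ginv g)" for s g h
    using that by (cases s) (simp_all add: group_simps)
  have "\<exists>d. (u, v) = dihedral d (gen_a, gen_b)"
  proof (cases x)
    case GenA
    then have y: "y = GenB" using \<open>x \<noteq> y\<close> by (cases y) auto
    have "u = signed s gen_a" "v = signed t gen_b"
      using j k unfolding xs yt GenA y lval.simps by (auto intro: signed)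
    then show ?thesis by (intro exI[of _ "(False, s, t)"]) simp
  next
    case GenB
    then have y: "y = GenA" using \<open>x \<noteq> y\<close> by (cases y) auto
    have "v = signed s gen_a" "u = signed t gen_b"
      using j k unfolding xs yt GenB y lval.simps by (auto intro: signed)
    then show ?thesis by (intro exI[of _ "(True, s, t)"]) simp
  qed
  then show ?thesis using standard_word[of "[]"] by auto
qed

lemma basis_nontrivial:
  assumes "basis (u, v)"
  shows "u \<noteq> \<e>" "v \<noteq> \<e>"
proof -
  have "inj (ev u v)" using assms by (simp add: free_basis_iff bij_is_inj)
  moreover have "gen_a \<noteq> \<e>" "gen_b \<noteq> \<e>"
    using len_gens(1,2) len_eq_0[of gen_a] len_eq_0[of gen_b] by (simp_all del: len_eq_0)
  ultimately have "ev u v gen_a \<noteq> ev u v \<e>" "ev u v gen_b \<noteq> ev u v \<e>"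
    by (simp_all only: inj_eq not_False_eq_True)
  then show "u \<noteq> \<e>" "v \<noteq> \<e>" by simp_all
qed

text \<open>The quantity that Nielsen reduction decreases.\<close>

definition pair_len :: "gpair \<Rightarrow> nat" where "pair_len p = len (fst p) + len (snd p)"

lemma len_signed [simp]: "len (signed e g) = len g" by (cases e) auto

lemma pair_len_dihedral: "pair_len (dihedral d p) = pair_len p"
  by (cases p; cases d) (auto simp: pair_len_def)

text \<open>The induction step of Nielsen reduction: all free bases of total length less than \<open>n\<close> are assumed
  to be standard, and a basis of length \<open>n\<close> with too much cancellation is shortened.\<close>

context
  fixes n
  assumes smaller: "\<And>p. basis p \<Longrightarrow> pair_len p < n \<Longrightarrow> standard p"
begin

lemma standard_if_unstep:
  assumes "standard (u, ginv u \<cdot> v)"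
  shows "standard (u, v)"
  using standard_step[OF assms] by (simp add: group_simps)

text \<open>If more than half of \<open>u\<close> cancels in the product of its inverse with \<open>v\<close>, then this product is
  shorter than \<open>v\<close>; similarly with the roles exchanged.\<close>

lemma standard_if_overlap:
  assumes "basis (u, v)" "pair_len (u, v) = n" "len u < 2 * gromov u v \<or> len v < 2 * gromov u v"
  shows "standard (u, v)"
proof -
  have *: "standard (x, y)" if "basis (x, y)" "pair_len (x, y) = n" "len x < 2 * gromov x y" for x y
  proof (rule standard_if_unstep, rule smaller[OF basis_unstep[OF that(1)]])
    show "pair_len (x, ginv x \<cdot> y) < n"
      using that len_mul[of x y] by (simp add: pair_len_def)
  qed
  have swap: "dihedral (True, True, True) (u, v) = (v, u)" by simp
  show ?thesis
    using assms *[of u v] *[of v u] basis_dihedral[OF assms(1), of "(True, True, True)"]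
      standard_dihedral_iff[of "(True, True, True)" "(u, v)"]
    unfolding swap by (auto simp: pair_len_def gromov_commute add.commute)
qed

text \<open>The remaining case, in which exactly half of \<open>u\<close> cancels on each side. Then \<open>u = p q\<^sup>-\<^sup>1\<close> and
  \<open>v = p m q\<^sup>-\<^sup>1\<close> with \<open>p\<close> and \<open>q\<close> of the same length, and conjugating \<open>(u, v u\<^sup>-\<^sup>1)\<close> by \<open>p\<^sup>-\<^sup>1\<close> gives
  \<open>(q\<^sup>-\<^sup>1 p, m)\<close>, which is shorter. In rank two this replaces the well-ordering of words by which Nielsen's
  method usually breaks such ties.\<close>

lemma standard_if_half_overlap:
  assumes uv: "basis (u, v)" "pair_len (u, v) = n"
    and half: "2 * gromov u v = len u" "2 * gromov (ginv u) (ginv v) = len u" "len u \<le> len v"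
  shows "standard (u, v)"
proof -
  define h where "h = gromov u v"
  have h: "len u = 2 * h" "gromov (ginv u) (ginv v) = h" "gromov u v = h" "2 * h \<le> len v"
    using half by (simp_all add: h_def)
  have "0 < h"
    using basis_nontrivial(1)[OF uv(1)] len_eq_0[of u] h(1) by (simp del: len_eq_0)
  obtain p where p: "len p = h" "gromov p u = h"
    using prefix_exists[of h u] h by auto
  define q where "q = ginv u \<cdot> p"
  have q: "len q = h"
    using len_mul[of u p] p h by (simp add: q_def gromov_commute)
  have "gromov q (ginv u) = h"
    using gromov_mul[of "ginv u" p] p h by (simp add: q_def gromov_commute group_simps)
  then have qv: "h \<le> gromov q (ginv v)"
    using gromov_ultra[of q "ginv u" "ginv v"] h by simp
  have pv: "gromov p v = h"
    using gromov_ultra[of p u v] gromov_le[of p v] p h by simp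
  have "len (ginv p \<cdot> u) = h"
    using len_mul[of p u] p h by simp
  then have u': "len (ginv p \<cdot> u \<cdot> p) \<le> len u"
    using len_mul'[of "ginv p \<cdot> u" p] p h by simp
  have "gromov (ginv v) (ginv v \<cdot> p) + h = len v"
    using gromov_mul[of "ginv v" p] pv by (simp add: group_simps gromov_commute)
  then have "h \<le> gromov q (ginv v \<cdot> p)"
    using gromov_ultra[of q "ginv v" "ginv v \<cdot> p"] qv h by simp
  then have v': "len (ginv p \<cdot> v \<cdot> q) < len v"
    using len_mul'[of "ginv p \<cdot> v" q] len_mul[of p v] pv p q h(4) \<open>0 < h\<close>
    by (simp add: group_simps gromov_commute[of q])
  let ?r = "conj_pair (ginv p) (conj_pair u (u, ginv u \<cdot> v))"
  have "standard ?r"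
  proof (rule smaller)
    show "basis ?r" by (intro basis_conj_pair basis_unstep uv)
    show "pair_len ?r < n"
      using u' v' uv(2) by (simp add: pair_len_def q_def group_simps)
  qed
  then show ?thesis
    by (simp add: standard_conj_pair_iff standard_if_unstep del: conj_pair.simps)
qed

text \<open>Unless one of the previous two lemmas applies, cancellation of \<open>u\<close> on either side is at most half of
  \<open>u\<close>, and less than half against \<open>u\<close> itself. So if all of \<open>u\<close> is consumed by \<open>x\<close> and \<open>z\<close>, each of them is
  \<open>v\<close> or its inverse. If they were equal, then so would be the halves \<open>p\<close> and \<open>q\<close> of \<open>u = p q\<^sup>-\<^sup>1\<close>, and
  \<open>u\<close> would be trivial; hence they are inverse to each other.\<close>

lemma standard_if_cancel:
  assumes uv: "basis (u, v)" "pair_len (u, v) = n"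
    and x: "x = ginv u \<or> x = v \<or> x = ginv v"
    and z: "z = u \<or> z = v \<or> z = ginv v"
    and big: "len u \<le> gromov x u + gromov (ginv u) z"
  shows "standard (u, v)"
proof (rule ccontr)
  assume contra: "\<not> standard (u, v)"
  have small: "2 * gromov (signed e u) (signed f v) \<le> len u \<and> 2 * gromov (signed e u) (signed f v) \<le> len v" for e f
  proof -
    have "\<not> standard (signed e u, signed f v)" "basis (signed e u, signed f v)" "pair_len (signed e u, signed f v) = n"
      using contra standard_dihedral_iff[of "(False, e, f)" "(u, v)"] basis_dihedral[OF uv(1), of "(False, e, f)"]
        uv(2) pair_len_dihedral[of "(False, e, f)" "(u, v)"] by simp_all
    then have "\<not> (len (signed e u) < 2 * gromov (signed e u) (signed f v) \<or> len (signed f v) < 2 * gromov (signed e u) (signed f v))"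
      using standard_if_overlap[of "signed e u" "signed f v"] by blast
    then show ?thesis by (simp add: not_less)
  qed
  have pm: "2 * gromov u v \<le> len u \<and> 2 * gromov u v \<le> len v" "2 * gromov u (ginv v) \<le> len u"
    "2 * gromov (ginv u) v \<le> len u" "2 * gromov (ginv u) (ginv v) \<le> len u"
    using small[of True True] small[of True False] small[of False True] small[of False False] by simp_all
  have uu: "2 * gromov u (ginv u) < len u"
    using gromov_inverse_small basis_nontrivial[OF uv(1)] by blast
  have sx: "2 * gromov x u \<le> len u" and sz: "2 * gromov (ginv u) z \<le> len u"
    using x z pm uu by (auto simp: gromov_commute)
  then have eq: "2 * gromov x u = len u" "2 * gromov (ginv u) z = len u"
    using big by linarith+
  then have xz: "x = v \<or> x = ginv v" "z = v \<or> z = ginv v"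
    using x z uu by (auto simp: gromov_commute)
  have "x \<noteq> z"
  proof
    assume "x = z"
    then show False
      using gromov_ultra[of u x "ginv u"] eq uu by (auto simp: gromov_commute min_def split: if_splits)
  qed
  then obtain f where f: "x = signed f v" "z = ginv (signed f v)"
    using xz by (metis signed.simps group_simps(8))
  have "standard (u, signed f v)"
  proof (rule standard_if_half_overlap)
    show "basis (u, signed f v)" using basis_dihedral[OF uv(1), of "(False, True, f)"] by simp
    show "pair_len (u, signed f v) = n" using uv(2) by (simp add: pair_len_def)
    show "2 * gromov u (signed f v) = len u" "2 * gromov (ginv u) (ginv (signed f v)) = len u"
      using eq f by (simp_all add: gromov_commute)
    show "len u \<le> len (signed f v)"
      using eq f small[of True f] by (simp add: gromov_commute)
  qed
  then show False
    using contra standard_dihedral_iff[of "(False, True, f)" "(u, v)"] by simp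
qed

end

text \<open>Induction on the total length. A signed permutation moves the letter \<open>j\<close> that is consumed by its
  neighbours to the first place.\<close>

proposition basis_standard: "basis p \<Longrightarrow> standard p"
proof (induction "pair_len p" arbitrary: p rule: less_induct)
  case less
  obtain u v where p: "p = (u, v)" by (cases p)
  show ?case
  proof (cases "no_cancel u v")
    case True
    then show ?thesis using standard_if_no_cancel less.prems p by blast
  next
    case False
    then obtain i j k where ijk: "i \<noteq> letter_inv j" "k \<noteq> letter_inv j"
      "\<not> gromov (ginv (lval u v i)) (lval u v j) + gromov (ginv (lval u v j)) (lval u v k) < len (lval u v j)"
      unfolding no_cancel_def by blast
    obtain g s where j: "j = (g, s)" by (cases j)
    (* swap if the letter belongs to the second generator, and invert the generator of the letter if the letter is an inverse *)
    define d where "d = (g = GenB, g = GenA \<longrightarrow> s, g = GenB \<longrightarrow> s)"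
    define x y where "x = fst (dihedral d p)" and "y = snd (dihedral d p)"
    have xy: "dihedral d p = (x, y)" by (simp add: x_def y_def)
    have lj: "lval u v j = x"
      by (cases g; cases s) (auto simp: j x_def d_def p)
    have li: "lval u v l = x \<or> lval u v l = y \<or> lval u v l = ginv y" if "l \<noteq> letter_inv j" for l
      using that by (cases g; cases s; cases "(u, v, l)" rule: lval.cases)
        (auto simp: j x_def y_def d_def p group_simps split: if_splits)
    have "standard (x, y)"
    proof (rule standard_if_cancel[of "pair_len p"])
      show "standard q" if "basis q" "pair_len q < pair_len p" for q
        using less.hyps that by blast
      show "basis (x, y)" using basis_dihedral[OF less.prems, of d] xy by simp
      show "pair_len (x, y) = pair_len p" using pair_len_dihedral[of d p] xy by simp
      show "ginv (lval u v i) = ginv x \<or> ginv (lval u v i) = y \<or> ginv (lval u v i) = ginv y"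
        using li[OF ijk(1)] by (auto simp: group_simps)
      show "lval u v k = x \<or> lval u v k = y \<or> lval u v k = ginv y"
        by (rule li[OF ijk(2)])
      show "len x \<le> gromov (ginv (lval u v i)) x + gromov (ginv x) (lval u v k)"
        using ijk(3) by (simp only: lj not_less)
    qed
    then show ?thesis using standard_dihedral_iff[of d p] xy by simp
  qed
qed

section \<open>Slopes of the curves met by a word\<close>

text \<open>The exponents of \<open>a\<close> and \<open>b\<close> in \<open>u v\<close>, where \<open>(u, v)\<close> is what the word \<open>w\<close> makes of \<open>(a, b)\<close>. As a fraction
  this is the node of the Stern--Brocot tree with address \<open>w\<close>.\<close>

fun stern_brocot :: "bool list \<Rightarrow> nat \<times> nat" where
  "stern_brocot [] = (1, 1)"
| "stern_brocot (True # w) = (fst (stern_brocot w) + snd (stern_brocot w), snd (stern_brocot w))"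
| "stern_brocot (False # w) = (fst (stern_brocot w), fst (stern_brocot w) + snd (stern_brocot w))"

lemma stern_brocot_pos: "0 < fst (stern_brocot w) \<and> 0 < snd (stern_brocot w)"
  by (induction w rule: stern_brocot.induct) auto

text \<open>The first letter is recovered by comparing the two numbers, as in the subtractive form of Euclid's
  algorithm.\<close>

lemma inj_stern_brocot: "inj stern_brocot"
proof (rule injI)
  show "v = w" if "stern_brocot v = stern_brocot w" for v w
    using that
  proof (induction v arbitrary: w)
    case Nil
    then show ?case
      using stern_brocot_pos[of "tl w"] by (cases w rule: stern_brocot.cases) (auto simp: prod_eq_iff)
  next
    case (Cons l v)
    obtain m w' where w: "w = m # w'"
      using Cons.prems stern_brocot_pos[of v] by (cases w; cases l) (auto simp: prod_eq_iff)
    have "l = m"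
      using Cons.prems stern_brocot_pos[of v] stern_brocot_pos[of w']
      by (cases l; cases m) (auto simp: w)
    then have "stern_brocot v = stern_brocot w'"
      using Cons.prems by (cases l) (auto simp: w prod_eq_iff)
    then show ?case using Cons.IH w \<open>l = m\<close> by simp
  qed
qed

lemma exp_sum_mul: "exp_sum x (g \<cdot> h) = exp_sum x g + exp_sum x h"
  unfolding \<Gamma>_def monoid.simps by transfer simp

lemma exp_sum_one [simp]: "exp_sum x \<e> = 0"
  using exp_sum_mul[of x \<e> \<e>] by (simp add: group_simps)

lemma exp_sum_ginv: "exp_sum x (ginv g) = - exp_sum x g"
  using exp_sum_mul[of x g "ginv g"] by (simp add: group_simps)

lemma exp_sum_gens:
  "exp_sum GenA gen_a = 1" "exp_sum GenA gen_b = 0" "exp_sum GenB gen_a = 0" "exp_sum GenB gen_b = 1"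
  unfolding gen_a_def gen_b_def by (transfer, simp add: letter_exp_def)+

lemma exp_sum_pair_run:
  "exp_sum x (fst (pair_run w (u, v)) \<cdot> snd (pair_run w (u, v)))
    = int (fst (stern_brocot w)) * exp_sum x u + int (snd (stern_brocot w)) * exp_sum x v"
proof (induction w arbitrary: u v)
  case (Cons l w)
  then show ?case by (cases l) (auto simp: exp_sum_mul algebra_simps)
qed (simp add: exp_sum_mul)

text \<open>The curve whose trace is the front entry.\<close>

definition front_curve :: "bool \<times> bool \<times> bool \<Rightarrow> bool list \<Rightarrow> free2" where
  "front_curve d w = (case pair_run w (dihedral d (gen_a, gen_b)) of (u, v) \<Rightarrow> u \<cdot> v)"

lemma exp_sum_front_curve:
  "(nat \<bar>exp_sum GenA (front_curve d w)\<bar>, nat \<bar>exp_sum GenB (front_curve d w)\<bar>)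
    = (if fst d then prod.swap (stern_brocot w) else stern_brocot w)"
proof -
  obtain s e f where d: "d = (s, e, f)" by (cases d)
  have signed: "exp_sum x (signed b g) = (if b then exp_sum x g else - exp_sum x g)" for x b g
    by (cases b) (auto simp: exp_sum_ginv)
  show ?thesis
    using exp_sum_pair_run[of GenA w "fst (dihedral d (gen_a, gen_b))" "snd (dihedral d (gen_a, gen_b))"]
      exp_sum_pair_run[of GenB w "fst (dihedral d (gen_a, gen_b))" "snd (dihedral d (gen_a, gen_b))"]
    by (auto simp: front_curve_def case_prod_beta d signed exp_sum_gens prod_eq_iff)
qed

lemma curve_rel_exp_sum:
  assumes "(g, h) \<in> curve_rel"
  shows "\<bar>exp_sum x g\<bar> = \<bar>exp_sum x h\<bar>"
  using assms by (auto simp: curve_rel_def exp_sum_mul exp_sum_ginv)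

lemma curve_rel_refl: "(g, g) \<in> curve_rel"
  unfolding curve_rel_def
  by (intro CollectI case_prodI bexI[of _ \<e>] disjI1) (simp_all add: group_simps)

text \<open>Conjugate or inverse elements have the same exponents up to sign, and those of a front curve
  determine the word.\<close>

lemma inj_front_class: "inj (\<lambda>w. curve_rel `` {front_curve d w})"
proof (rule injI)
  fix v w
  assume "curve_rel `` {front_curve d v} = curve_rel `` {front_curve d w}"
  then have rel: "(front_curve d v, front_curve d w) \<in> curve_rel"
    using curve_rel_refl by blast
  have "(if fst d then prod.swap (stern_brocot v) else stern_brocot v)
      = (if fst d then prod.swap (stern_brocot w) else stern_brocot w)"
    unfolding exp_sum_front_curve[symmetric] curve_rel_exp_sum[OF rel] ..
  then have "stern_brocot v = stern_brocot w"
    by (cases "fst d") (auto simp: prod_eq_iff)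
  then show "v = w" using inj_stern_brocot by (simp add: inj_eq)
qed

lemma free_basis_swap: "free_basis u v \<Longrightarrow> free_basis v u"
  using basis_dihedral[of "(u, v)" "(True, True, True)"] by simp

lemma free_basis_front: "\<exists>v. free_basis (front_curve d w) v"
proof -
  obtain u v where uv: "pair_run w (dihedral d (gen_a, gen_b)) = (u, v)" by fastforce
  then have "basis (pair_step False (u, v))"
    using basis_pair_step basis_pair_run basis_dihedral basis_gen by metis
  then show ?thesis using uv by (auto simp: front_curve_def)
qed

lemma class_in_Omega_hat: "free_basis g v \<Longrightarrow> curve_rel `` {g} \<in> Omega_hat"
  unfolding Omega_hat_def by (rule quotientI) auto

section \<open>Trace triples of representations\<close>

text \<open>The action of signed permutations on trace triples. The product of the two members has
  trace \<open>z\<close> if the signs agree and \<open>x y - z\<close>, the trace of \<open>u v\<^sup>-\<^sup>1\<close>, if they differ.\<close>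

fun dihedral_state :: "bool \<times> bool \<times> bool \<Rightarrow> state \<Rightarrow> state" where
  "dihedral_state (s, e, f) (x, y, z) =
    (let z' = (if e = f then z else x * y - z) in if s then (y, x, z') else (x, y, z'))"

lemma kappa_dihedral_state [simp]: "kappa (dihedral_state d s) = kappa s"
  by (cases d; cases s) (auto simp: Let_def power2_eq_square algebra_simps)

lemma continuous_dihedral_state: "continuous_on UNIV (dihedral_state d)"
proof -
  obtain s e f where d: "d = (s, e, f)" by (cases d)
  have "dihedral_state d = (\<lambda>(x, y, z). (if s then y else x, if s then x else y, if e = f then z else x * y - z))"
    by (auto simp: d Let_def)
  then have "dihedral_state d = (\<lambda>t. (if s then fst (snd t) else fst t, if s then fst t else fst (snd t),
      if e = f then snd (snd t) else fst t * fst (snd t) - snd (snd t)))"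
    by (auto simp: d)
  then show ?thesis
    by (cases s; cases "e = f") (simp_all, (intro continuous_intros)+)
qed

lemma bounded_by_dihedral_state:
  assumes "bounded_by B (dihedral_state d s)"
  shows "bounded_by (B + B * B) s"
proof -
  obtain x y z where s: "s = (x, y, z)" by (cases s)
  obtain t e f where d: "d = (t, e, f)" by (cases d)
  define z' where "z' = (if e = f then z else x * y - z)"
  have b: "cmod x \<le> B" "cmod y \<le> B" "cmod z' \<le> B"
    using assms by (auto simp: s d z'_def Let_def split: if_splits)
  have "0 \<le> B" using norm_ge_zero b(1) by (rule order_trans)
  have xy: "cmod x * cmod y \<le> B * B"
    using b \<open>0 \<le> B\<close> by (intro mult_mono) auto
  have "cmod z \<le> cmod z' + cmod x * cmod y"
  proof (cases "e = f")
    case False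
    then have "z = x * y - z'" by (simp add: z'_def)
    then show ?thesis using norm_triangle_ineq4[of "x * y" z'] by (simp add: norm_mult)
  qed (simp add: z'_def)
  moreover have "0 \<le> B * B" by simp
  ultimately show ?thesis
    unfolding s bounded_by.simps using b xy by (intro conjI; linarith)
qed

text \<open>The Cayley--Hamilton theorem \<open>A\<^sup>2 = (trace A) A - 1\<close>, multiplied by \<open>B\<close>.\<close>

lemma trace_square_mul:
  fixes A B :: "complex^2^2"
  assumes "det A = 1"
  shows "trace (A ** (A ** B)) = trace A * trace (A ** B) - trace B"
proof -
  have "trace (A ** (A ** B)) - trace A * trace (A ** B) + det A * trace B = 0"
    by (simp add: trace_def matrix_matrix_mult_def sum_2 det_2 algebra_simps)
  then show ?thesis using assms by (simp add: algebra_simps)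
qed

fun trace_triple :: "(free2 \<Rightarrow> complex^2^2) \<Rightarrow> gpair \<Rightarrow> state" where
  "trace_triple \<rho> (u, v) = (trace (\<rho> u), trace (\<rho> v), trace (\<rho> (u \<cdot> v)))"

lemma trace_coords_eq: "trace_coords \<rho> = trace_triple \<rho> (gen_a, gen_b)"
  by (simp add: trace_coords_def)

locale SL2_rep =
  fixes \<rho> :: "free2 \<Rightarrow> complex^2^2"
  assumes hom: "\<rho> \<in> hom \<Gamma> SL2C"
begin

abbreviation tr where "tr g \<equiv> trace (\<rho> g)"

lemma rep_mul: "\<rho> (g \<cdot> h) = \<rho> g ** \<rho> h"
  using hom by (auto simp: hom_def SL2C_def)

lemma rep_det: "det (\<rho> g) = 1"
  using hom by (auto simp: hom_def SL2C_def)

lemma rep_one: "\<rho> \<e> = mat 1"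
proof -
  interpret group_hom \<Gamma> SL2C \<rho>
    using hom group_SL2C group_\<Gamma> by (simp add: group_hom_def group_hom_axioms_def)
  show ?thesis using hom_one by (simp add: SL2C_def)
qed

lemma tr_commute: "tr (g \<cdot> h) = tr (h \<cdot> g)"
  unfolding rep_mul by (rule trace_mul_sym)

lemma tr_square: "tr (g \<cdot> (g \<cdot> h)) = tr g * tr (g \<cdot> h) - tr h"
  unfolding rep_mul by (rule trace_square_mul[OF rep_det])

lemma tr_one: "tr \<e> = 2"
  unfolding rep_one by (simp add: trace_I)

lemma tr_ginv_mul: "tr (ginv g \<cdot> h) = tr g * tr h - tr (g \<cdot> h)"
  using tr_square[of g "ginv g \<cdot> h"] by (simp add: group_simps)

lemma tr_ginv: "tr (ginv g) = tr g"
  using tr_ginv_mul[of g \<e>] by (simp add: group_simps tr_one)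

lemma tr_conj: "tr (k \<cdot> g \<cdot> ginv k) = tr g"
  using tr_commute[of k "g \<cdot> ginv k"] by (simp add: group_simps)

lemma triple_pair_step: "trace_triple \<rho> (pair_step b p) = step b (trace_triple \<rho> p)"
proof -
  obtain u v where p: "p = (u, v)" by (cases p)
  have "tr (u \<cdot> (v \<cdot> v)) = tr (u \<cdot> v) * tr v - tr u"
    using tr_square[of v u] tr_commute[of "u \<cdot> v" v] tr_commute[of v "v \<cdot> u"] tr_commute[of u v]
      tr_commute[of u "v \<cdot> v"] by (simp add: group_simps)
  then show ?thesis
    by (cases b) (auto simp: p tr_square group_simps)
qed

lemma triple_pair_run: "trace_triple \<rho> (pair_run w p) = run w (trace_triple \<rho> p)"
  by (induction w arbitrary: p) (simp_all add: triple_pair_step del: trace_triple.simps split_paired_All)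

lemma triple_conj_pair: "trace_triple \<rho> (conj_pair g p) = trace_triple \<rho> p"
proof -
  obtain u v where p: "p = (u, v)" by (cases p)
  have "g \<cdot> u \<cdot> ginv g \<cdot> (g \<cdot> v \<cdot> ginv g) = g \<cdot> (u \<cdot> v) \<cdot> ginv g" by (simp add: group_simps)
  then show ?thesis by (simp only: p conj_pair.simps trace_triple.simps tr_conj)
qed

lemma triple_dihedral: "trace_triple \<rho> (dihedral d p) = dihedral_state d (trace_triple \<rho> p)"
proof -
  obtain u v where p: "p = (u, v)" by (cases p)
  obtain s e f where d: "d = (s, e, f)" by (cases d)
  have signed: "tr (signed b g) = tr g" for b g by (cases b) (auto simp: tr_ginv)
  have 1: "tr (ginv u \<cdot> v) = tr u * tr v - tr (u \<cdot> v)" by (rule tr_ginv_mul)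
  have 2: "tr (u \<cdot> ginv v) = tr u * tr v - tr (u \<cdot> v)"
    using tr_ginv_mul[of v u] tr_commute[of u v] tr_commute[of u "ginv v"] by simp
  have 3: "tr (ginv u \<cdot> ginv v) = tr (u \<cdot> v)"
    using tr_ginv[of "v \<cdot> u"] tr_commute[of u v] by (simp add: group_simps)
  have prod: "tr (signed e u \<cdot> signed f v) = (if e = f then tr (u \<cdot> v) else tr u * tr v - tr (u \<cdot> v))"
    by (cases e; cases f) (auto simp: 1 2 3)
  show ?thesis
    using prod tr_commute[of "signed e u" "signed f v"] by (cases s) (auto simp: p d signed Let_def)
qed

text \<open>Fricke's identity. Three applications of \<open>tr_ginv_mul\<close> reduce the trace of the commutator to
  traces of \<open>u\<close>, \<open>v\<close>, \<open>u v\<close>.\<close>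

lemma kappa_triple: "kappa (trace_triple \<rho> (u, v)) = tr (u \<cdot> v \<cdot> ginv u \<cdot> ginv v) + 2"
proof -
  let ?x = "tr u" and ?y = "tr v" and ?z = "tr (u \<cdot> v)"
  have a: "tr (ginv v \<cdot> ginv v) = ?y * ?y - 2"
    using tr_ginv_mul[of v "ginv v"] by (simp add: group_simps tr_one tr_ginv)
  have b: "tr (ginv u \<cdot> (v \<cdot> (ginv u \<cdot> ginv v))) = (?x * ?y - ?z) * ?z - tr (ginv v \<cdot> ginv v)"
    using tr_ginv_mul[of "ginv v \<cdot> u" "ginv u \<cdot> ginv v"] tr_ginv[of "v \<cdot> u"]
      tr_commute[of v u] tr_commute[of "ginv v" u] tr_ginv_mul[of v u]
    by (simp add: group_simps mult.commute)
  have c: "tr (u \<cdot> (v \<cdot> (ginv u \<cdot> ginv v))) = ?x * ?x - tr (ginv u \<cdot> (v \<cdot> (ginv u \<cdot> ginv v)))"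
    using tr_ginv_mul[of "ginv u" "v \<cdot> (ginv u \<cdot> ginv v)"] tr_conj[of v "ginv u"]
    by (simp add: group_simps tr_ginv)
  show ?thesis
    unfolding trace_triple.simps kappa.simps group_simps c b a
    by (simp add: power2_eq_square algebra_simps)
qed

text \<open>All traces that occur are traces of members of free bases, hence of elements of classes in
  \<open>Omega_hat\<close>, to which (BQ1) applies; (BQ2) applies because distinct words have distinct front
  classes.\<close>

lemma BQ_state_triple:
  assumes "\<tau> \<noteq> 2" "tr comm_ab = \<tau>" "BQ1 \<rho>" "BQ2 \<rho>"
  shows "BQ_state (dihedral_state d (trace_coords \<rho>))"
  unfolding BQ_state_def
proof (intro conjI allI impI)
  let ?s = "dihedral_state d (trace_coords \<rho>)" and ?p = "dihedral d (gen_a, gen_b)"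
  have run: "run w ?s = trace_triple \<rho> (pair_run w ?p)" for w
    by (simp only: triple_pair_run triple_dihedral trace_coords_eq)
  have kappa: "kappa ?s = \<tau> + 2"
    unfolding kappa_dihedral_state trace_coords_eq kappa_triple assms(2)[unfolded comm_ab_def] ..
  have "\<tau> = 2" if "\<tau> + 2 = 4"
    using that by (metis add_diff_cancel_right' numeral_Bit0 one_add_one)
  then show "kappa ?s \<noteq> 4"
    unfolding kappa using assms(1) by blast
  have primitive: "tr g \<notin> complex_of_real ` {-2..2}" if "free_basis g v" for g v
  proof -
    have "g \<in> curve_rel `` {g}" using curve_rel_refl by blast
    then show ?thesis
      using assms(3) class_in_Omega_hat[OF that] unfolding BQ1_def by blast
  qed
  {
    fix w x y z
    assume xyz: "run w ?s = (x, y, z)"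
    obtain u v where uv: "pair_run w ?p = (u, v)" by (cases "pair_run w ?p")
    have uv_basis: "free_basis u v"
      using basis_pair_run[OF basis_dihedral[OF basis_gen], of w d] unfolding uv by simp
    have xy: "x = tr u" "y = tr v"
      using xyz unfolding run uv trace_triple.simps prod.inject by blast+
    show "x \<notin> complex_of_real ` {-2..2}" "y \<notin> complex_of_real ` {-2..2}"
      unfolding xy by (rule primitive[OF uv_basis], rule primitive[OF free_basis_swap[OF uv_basis]])
  }
  have front: "front (run w ?s) = tr (front_curve d w)" for w
    unfolding run front_curve_def by (cases "pair_run w ?p") (simp only: trace_triple.simps front.simps prod.case)
  let ?S = "{c \<in> Omega_hat. \<exists>g\<in>c. cmod (tr g) \<le> 2}"
  have "{w. cmod (front (run w ?s)) \<le> 2} \<subseteq> (\<lambda>w. curve_rel `` {front_curve d w}) -` ?S"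
  proof
    fix w assume "w \<in> {w. cmod (front (run w ?s)) \<le> 2}"
    then have "cmod (tr (front_curve d w)) \<le> 2" by (simp only: front mem_Collect_eq)
    moreover have "front_curve d w \<in> curve_rel `` {front_curve d w}"
      using curve_rel_refl by blast
    moreover have "curve_rel `` {front_curve d w} \<in> Omega_hat"
      using free_basis_front class_in_Omega_hat by blast
    ultimately show "w \<in> (\<lambda>w. curve_rel `` {front_curve d w}) -` ?S" by blast
  qed
  moreover have "finite ((\<lambda>w. curve_rel `` {front_curve d w}) -` ?S)"
    using assms(4) inj_front_class by (intro finite_vimageI) (simp_all add: BQ2_def)
  ultimately show "finite {w. cmod (front (run w ?s)) \<le> 2}"
    by (rule finite_subset)
qed

end

section \<open>Mapping classes and proper discontinuity\<close>

definition conj_by :: "free2 \<Rightarrow> free2 \<Rightarrow> free2" where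
  "conj_by g x = g \<cdot> x \<cdot> ginv g"

lemma conj_by_comp: "conj_by g \<circ> conj_by h = conj_by (g \<cdot> h)"
  by (auto simp: conj_by_def fun_eq_iff group_simps)

lemma Inn_eq: "Inn = range conj_by"
  by (auto simp: Inn_def conj_by_def fun_eq_iff)

lemma conj_by_Bij: "conj_by g \<in> Bij UNIV"
proof -
  have "bij (conj_by g)"
    by (rule o_bij[of "conj_by (ginv g)"]) (auto simp: conj_by_def fun_eq_iff group_simps)
  then show ?thesis by (simp add: Bij_def)
qed

text \<open>An element of \<open>MCG\<close> is the coset of an automorphism modulo the inner ones, written without the
  operations of the group of automorphisms.\<close>

lemma mcg_carrierE:
  assumes "H \<in> carrier MCG"
  obtains \<phi> where "H = {conj_by g \<circ> \<phi> | g. True}" "\<phi> \<in> hom \<Gamma> \<Gamma>" "bij \<phi>"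
proof -
  obtain \<phi> where \<phi>: "\<phi> \<in> auto \<Gamma>" "H = Inn #>\<^bsub>Aut_plus\<^esub> \<phi>"
    using assms by (auto simp: MCG_def FactGroup_def RCOSETS_def Aut_plus_def)
  have "\<phi> \<in> Bij UNIV" using \<phi>(1) by (simp add: auto_def)
  then have "conj_by g \<otimes>\<^bsub>Aut_plus\<^esub> \<phi> = conj_by g \<circ> \<phi>" for g
    using conj_by_Bij by (simp add: Aut_plus_def AutoGroup_def BijGroup_def compose_def fun_eq_iff)
  then have "H = {conj_by g \<circ> \<phi> | g. True}"
    unfolding \<phi>(2) r_coset_def Inn_eq by auto
  then show ?thesis
    using that[of \<phi>] \<phi>(1) by (auto simp: auto_def Bij_def)
qed

text \<open>The data \<open>(d, w, d')\<close> describe the image of \<open>(a, b)\<close> under \<open>H\<close> as in \<open>standard\<close>.\<close>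

definition coded_by ::
  "(free2 \<Rightarrow> free2) set \<Rightarrow> (bool \<times> bool \<times> bool) \<times> bool list \<times> (bool \<times> bool \<times> bool) \<Rightarrow> bool" where
  "coded_by H k \<longleftrightarrow> (\<exists>\<phi>\<in>H. \<exists>g. (\<phi> gen_a, \<phi> gen_b) =
     conj_pair g (dihedral (snd (snd k)) (pair_run (fst (snd k)) (dihedral (fst k) (gen_a, gen_b)))))"

text \<open>An automorphism is determined by the images of \<open>a\<close> and \<open>b\<close>. If these are conjugate, by the same
  element, to the images under another automorphism, then the two automorphisms differ by an inner one.\<close>

lemma coded_by_unique:
  assumes "H \<in> carrier MCG" "H' \<in> carrier MCG" "coded_by H k" "coded_by H' k"
  shows "H = H'"
proof -
  define q where "q = dihedral (snd (snd k)) (pair_run (fst (snd k)) (dihedral (fst k) (gen_a, gen_b)))"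
  obtain \<phi> where H: "H = {conj_by g \<circ> \<phi> | g. True}" "\<phi> \<in> hom \<Gamma> \<Gamma>"
    using mcg_carrierE[OF assms(1)] by blast
  obtain \<phi>' where H': "H' = {conj_by g \<circ> \<phi>' | g. True}" "\<phi>' \<in> hom \<Gamma> \<Gamma>"
    using mcg_carrierE[OF assms(2)] by blast
  obtain g h where g: "conj_pair g (\<phi> gen_a, \<phi> gen_b) = conj_pair h q"
    using assms(3) unfolding coded_by_def H q_def[symmetric] by (auto simp: conj_by_def)
  obtain g' h' where g': "conj_pair g' (\<phi>' gen_a, \<phi>' gen_b) = conj_pair h' q"
    using assms(4) unfolding coded_by_def H' q_def[symmetric] by (auto simp: conj_by_def)
  define m where "m = ginv g' \<cdot> (h' \<cdot> (ginv h \<cdot> g))"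
  have q: "q = conj_pair (ginv h) (conj_pair g (\<phi> gen_a, \<phi> gen_b))"
    unfolding g conj_pair_conj_pair group_simps conj_pair_one ..
  have "conj_pair (ginv g') (conj_pair g' (\<phi>' gen_a, \<phi>' gen_b)) = conj_pair m (\<phi> gen_a, \<phi> gen_b)"
    unfolding g' q conj_pair_conj_pair m_def group_simps ..
  then have "(\<phi>' gen_a, \<phi>' gen_b) = conj_pair m (\<phi> gen_a, \<phi> gen_b)"
    unfolding conj_pair_conj_pair group_simps conj_pair_one .
  then have "ev (\<phi>' gen_a) (\<phi>' gen_b) x = conj_by m (ev (\<phi> gen_a) (\<phi> gen_b) x)" for x
    unfolding conj_pair.simps prod.inject conj_by_def by (simp only: ev_conj_pair)
  then have "\<phi>' x = conj_by m (\<phi> x)" for x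
    unfolding hom_eq_ev[OF H(2), symmetric] hom_eq_ev[OF H'(2), symmetric] .
  then have "\<phi>' = conj_by m \<circ> \<phi>"
    by (simp only: fun_eq_iff comp_apply) simp
  then have 1: "conj_by g \<circ> \<phi>' = conj_by (g \<cdot> m) \<circ> \<phi>" for g
    by (simp only: conj_by_comp[symmetric] comp_assoc)
  have 2: "conj_by g \<circ> \<phi> = conj_by (g \<cdot> ginv m) \<circ> \<phi>'" for g
    using 1[of "g \<cdot> ginv m"] by (simp add: group_simps)
  show ?thesis
    unfolding H(1) H'(1) using 1 2 by blast
qed

lemma trace_coords_conj:
  assumes "(\<rho>, \<rho>') \<in> conj_rel \<tau>"
  shows "trace_coords \<rho>' = trace_coords \<rho>"
proof -
  obtain P where P: "P \<in> carrier SL2C" "\<And>g. \<rho>' g = P \<otimes>\<^bsub>SL2C\<^esub> \<rho> g \<otimes>\<^bsub>SL2C\<^esub> inv\<^bsub>SL2C\<^esub> P"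
    using assms unfolding conj_rel_def by auto
  let ?Q = "inv\<^bsub>SL2C\<^esub> P"
  have "?Q ** P = mat 1"
    using group.l_inv[OF group_SL2C P(1)] by (simp add: SL2C_def)
  then have "trace (P ** A ** ?Q) = trace A" for A
    by (subst trace_mul_sym) (simp only: matrix_mul_assoc matrix_mul_lid)
  moreover have "\<rho>' g = P ** \<rho> g ** ?Q" for g
    unfolding P(2) by (simp add: SL2C_def)
  ultimately have "trace (\<rho>' g) = trace (\<rho> g)" for g
    by (simp only:)
  then show ?thesis by (simp only: trace_coords_def)
qed

lemma X_Q_E:
  assumes "c \<in> X_Q \<tau>"
  obtains \<rho> where "\<rho> \<in> c" "\<rho> \<in> tau_reps \<tau>" "BQ1 \<rho>" "BQ2 \<rho>"
    "\<forall>\<rho>'\<in>c. class_coords c = trace_coords \<rho>'"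
proof -
  obtain \<rho> where \<rho>: "\<rho> \<in> tau_reps \<tau>" "BQ1 \<rho>" "BQ2 \<rho>" "c = conj_rel \<tau> `` {\<rho>}"
    using assms by (auto simp: X_Q_def quotient_def)
  interpret S: group SL2C by (rule group_SL2C)
  have "\<rho> g \<in> carrier SL2C" for g
    using \<rho>(1) by (auto simp: tau_reps_def hom_def)
  then have "\<forall>g. \<rho> g = \<one>\<^bsub>SL2C\<^esub> \<otimes>\<^bsub>SL2C\<^esub> \<rho> g \<otimes>\<^bsub>SL2C\<^esub> inv\<^bsub>SL2C\<^esub> \<one>\<^bsub>SL2C\<^esub>"
    by (simp only: S.l_one S.r_one S.inv_one simp_thms)
  then have "(\<rho>, \<rho>) \<in> conj_rel \<tau>"
    unfolding conj_rel_def using \<rho>(1) S.one_closed by blast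
  then have mem: "\<rho> \<in> c" unfolding \<rho>(4) by blast
  have all: "trace_coords \<rho>' = trace_coords \<rho>" if "\<rho>' \<in> c" for \<rho>'
    using trace_coords_conj[of \<rho> \<rho>' \<tau>] that unfolding \<rho>(4) by blast
  then have "trace_coords ` c = {trace_coords \<rho>}" using mem by blast
  then have "class_coords c = trace_coords \<rho>" by (simp add: class_coords_def)
  then have "\<forall>\<rho>'\<in>c. class_coords c = trace_coords \<rho>'"
    using all by simp
  then show ?thesis by (rule that[OF mem \<rho>(1-3)])
qed

text \<open>Each mapping class that sends a point of \<open>K\<close> into \<open>K\<close> is coded by a triple \<open>(d, w, d')\<close> whose word
  belongs to a finite set depending on \<open>d\<close>, and distinct classes have distinct codes.\<close>

theorem theorem2p3:
  fixes \<tau> :: complex and K :: "(free2 \<Rightarrow> complex^2^2) set set"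
  assumes "\<tau> \<noteq> 2"
    and "compactin (subtopology (X_top \<tau>) (X_Q \<tau>)) K"
  shows "finite {H \<in> carrier MCG. mcg_act H ` K \<inter> K \<noteq> {}}"
proof -
  let ?C = "class_coords ` K"
  have K: "compactin (X_top \<tau>) K" "K \<subseteq> X_Q \<tau>"
    using assms(2) by (auto simp: compactin_subtopology)
  have "continuous_map (X_top \<tau>) euclidean class_coords"
    using continuous_map_pullback[of euclidean euclidean id] by (simp add: X_top_def)
  then have C: "compact ?C"
    using image_compactin[OF K(1)] by fastforce
  have BQ: "BQ_state s" if s: "s \<in> dihedral_state d ` ?C" for s d
  proof -
    obtain c where c: "c \<in> K" "s = dihedral_state d (class_coords c)" using s by blast
    have "c \<in> X_Q \<tau>" using K(2) c(1) by blast
    then obtain \<rho> where \<rho>: "\<rho> \<in> c" "\<rho> \<in> tau_reps \<tau>" "BQ1 \<rho>" "BQ2 \<rho>"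
      and coords: "class_coords c = trace_coords \<rho>"
      using X_Q_E[of c \<tau>] by blast
    interpret SL2_rep \<rho> using \<rho>(2) by unfold_locales (simp add: tau_reps_def)
    have "tr comm_ab = \<tau>" using \<rho>(2) by (simp add: tau_reps_def)
    then show ?thesis
      unfolding c(2) coords by (rule BQ_state_triple[OF assms(1) _ \<rho>(3,4)])
  qed
  obtain B where norm_le: "\<forall>s\<in>?C. norm s \<le> B"
    using compact_imp_bounded[OF C] unfolding bounded_iff by blast
  have B: "bounded_by B s" if "s \<in> ?C" for s
  proof -
    obtain x y z where s: "s = (x, y, z)" by (cases s)
    have "norm x \<le> norm s" "norm (y, z) \<le> norm s"
      using norm_fst_le[of x "(y, z)"] norm_snd_le[of "(y, z)" x] by (simp_all add: s)
    moreover have "norm y \<le> norm (y, z)" "norm z \<le> norm (y, z)"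
      using norm_fst_le[of y z] norm_snd_le[of z y] by simp_all
    ultimately show ?thesis using norm_le[rule_format, OF that] by (simp add: s)
  qed
  (* undoing the last signed permutation d' may change the bound B to B + B * B *)
  define words where "words d = {w. \<exists>s\<in>dihedral_state d ` ?C. bounded_by (B + B * B) (run w s)}" for d
  have "finite (words d)" for d
    unfolding words_def
    using compact_continuous_image[OF continuous_on_subset[OF continuous_dihedral_state] C] BQ
    by (intro finite_bounded_words) auto
  then have fin: "finite (SIGMA d:UNIV. words d \<times> (UNIV :: (bool \<times> bool \<times> bool) set))"
    by (intro finite_SigmaI finite_cartesian_product) auto
  have ex: "\<exists>k\<in>(SIGMA d:UNIV. words d \<times> UNIV). coded_by H k"
    if H: "H \<in> carrier MCG" "mcg_act H ` K \<inter> K \<noteq> {}" for H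
  proof -
    obtain c where c: "c \<in> K" "mcg_act H c \<in> K" using H(2) by blast
    have "c \<in> X_Q \<tau>" using K(2) c(1) by blast
    then obtain \<rho> where \<rho>: "\<rho> \<in> c" "\<rho> \<in> tau_reps \<tau>"
      and coords: "class_coords c = trace_coords \<rho>"
      using X_Q_E[of c \<tau>] by blast
    interpret SL2_rep \<rho> using \<rho>(2) by unfold_locales (simp add: tau_reps_def)
    obtain \<phi> where \<phi>: "H = {conj_by g \<circ> \<phi> | g. True}" "\<phi> \<in> hom \<Gamma> \<Gamma>" "bij \<phi>"
      using mcg_carrierE[OF H(1)] by blast
    have "conj_by \<e> \<circ> \<phi> = \<phi>" by (simp add: conj_by_def fun_eq_iff group_simps)
    then have mem: "\<phi> \<in> H" unfolding \<phi>(1) by (intro CollectI exI[of _ \<e>]) simp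
    have "basis (\<phi> gen_a, \<phi> gen_b)"
      unfolding basis.simps free_basis_iff hom_eq_ev[OF \<phi>(2), symmetric] by (rule \<phi>(3))
    then obtain g d w d' where std:
        "(\<phi> gen_a, \<phi> gen_b) = conj_pair g (dihedral d' (pair_run w (dihedral d (gen_a, gen_b))))"
      using basis_standard unfolding standard_def by blast
    have "\<rho> \<circ> \<phi> \<in> mcg_act H c" using \<rho>(1) mem unfolding mcg_act_def by blast
    moreover have "mcg_act H c \<in> X_Q \<tau>" using K(2) c(2) by blast
    ultimately have "class_coords (mcg_act H c) = trace_coords (\<rho> \<circ> \<phi>)"
      using X_Q_E[of "mcg_act H c" \<tau>] by blast
    also have "\<dots> = trace_triple \<rho> (\<phi> gen_a, \<phi> gen_b)"
      by (simp add: trace_coords_def hom_simps[OF \<phi>(2)])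
    also have "\<dots> = dihedral_state d' (run w (dihedral_state d (class_coords c)))"
      by (simp only: std triple_conj_pair triple_dihedral triple_pair_run coords trace_coords_eq)
    finally have "bounded_by B (dihedral_state d' (run w (dihedral_state d (class_coords c))))"
      using B[OF imageI[OF c(2)]] by (simp only:)
    then have "w \<in> words d"
      unfolding words_def using bounded_by_dihedral_state c(1) by blast
    moreover have "coded_by H (d, w, d')"
      unfolding coded_by_def fst_conv snd_conv using mem std by blast
    ultimately show ?thesis by blast
  qed
  define pick where "pick H = (SOME k. k \<in> (SIGMA d:UNIV. words d \<times> UNIV) \<and> coded_by H k)" for H
  have pick: "pick H \<in> (SIGMA d:UNIV. words d \<times> UNIV) \<and> coded_by H (pick H)"
    if "H \<in> {H \<in> carrier MCG. mcg_act H ` K \<inter> K \<noteq> {}}" for H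
  proof -
    have "\<exists>k. k \<in> (SIGMA d:UNIV. words d \<times> UNIV) \<and> coded_by H k" using ex[of H] that by blast
    then show ?thesis unfolding pick_def by (rule someI_ex)
  qed
  have "inj_on pick {H \<in> carrier MCG. mcg_act H ` K \<inter> K \<noteq> {}}"
  proof (rule inj_onI)
    fix H H'
    assume H: "H \<in> {H \<in> carrier MCG. mcg_act H ` K \<inter> K \<noteq> {}}"
      and H': "H' \<in> {H \<in> carrier MCG. mcg_act H ` K \<inter> K \<noteq> {}}" and eq: "pick H = pick H'"
    have "coded_by H (pick H)" "coded_by H' (pick H)"
      using pick[OF H] pick[OF H'] unfolding eq by blast+
    then show "H = H'" using H H' coded_by_unique by blast
  qed
  then show ?thesis
    by (rule inj_on_finite[OF _ _ fin]) (use pick in blast)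
qed

end
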